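(* Let $f$ be an exact symplectic $C^1$ twist map of $\mathbb{A}$ and let $M$ be an irrational Aubry-Mather set of $f$. If for all $x\in M$, $M$ is $C^1$-regular at $x$, then the Lyapunov exponents of $\mu(M,f)$ (for $f$) are zero.
   Context: $\mathbb{T}=\mathbb{R}/\mathbb{Z}$, $\mathbb{A}=\mathbb{T}\times\mathbb{R}$ with coordinates $(\theta,r)$, symplectic form $d\theta\wedge dr$ and its usual Riemannian metric. $\pi:\mathbb{A}\to\mathbb{T}$ is the first projection, $\tilde\pi:\mathbb{R}^2\to\mathbb{R}$ its lift, $p:\mathbb{R}^2\to\mathbb{A}$ the universal covering. A $C^1$ diffeomorphism $f:\mathbb{A}\to\mathbb{A}$ isotopic to the identity is a positive twist map if, for any lift $\tilde f:\mathbb{R}^2\to\mathbb{R}^2$ and every $\tilde\theta\in\mathbb{R}$, the maps $r\mapsto\tilde\pi\circ\tilde f(\tilde\theta,r)$ and $r\mapsto\tilde\pi\circ\tilde f^{-1}(\tilde\theta,r)$ are both diffeomorphisms (of $\mathbb{R}$), the first increasing and the second decreasing. If $f$ is a positive twist map, $f^{-1}$ is a negative twist map. A twist map may be positive or negative. $f$ is exact symplectic if the 1-form $f^*(r\,d\theta)-r\,d\theta$ is exact. A non-empty set $M\subset\mathbb{A}$ is $f$-ordered if it is compact, $f$-invariant, and for all $z,z'\in p^{-1}(M)$: $\tilde\pi(z)<\tilde\pi(z')\Leftrightarrow\tilde\pi(\tilde f(z))<\tilde\pi(\tilde f(z'))$. An Aubry-Mather set of $f$ is a minimal (for inclusion)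 $f$-ordered set. For an Aubry-Mather set $M$ there is a bi-Lipschitz orientation preserving homeomorphism $h$ of $\mathbb{T}$ with $\pi\circ f(\theta,r)=h(\theta)$ for all $(\theta,r)\in M$; the rotation number $\rho(M,\tilde f)$ is that of a lift $\tilde h$ of $h$ with $\tilde h(\tilde\theta)=\tilde\pi\circ\tilde f(\tilde\theta,r)$ on $p^{-1}(M)$. $M$ is irrational if $\rho(M,\tilde f)$ is irrational. Each Aubry-Mather set $M$ carries a unique $f$-invariant Borel probability measure, denoted $\mu(M,f)$; it is ergodic with support $M$. Its Lyapunov exponents are those of the cocycle $Df$ over $(f,\mu(M,f))$. For $M\subset\mathbb{A}$ and $x\in M$, the paratingent cone $P_M(x)\subset T_x\mathbb{A}$ is the set of limits $v=\lim_{n\to\infty}\frac{x_n-y_n}{t_n}$ where $(x_n),(y_n)$ are sequences in $M$ converging to $x$, $(t_n)$ is a sequence of positive reals converging to $0$, and $x_n-y_n$ denotes the lift in $[-\frac12,\frac12[^2\subset\mathbb{R}^2$. $M$ is $C^1$-regular at $x$ if there is a line $D$ of $T_x\mathbb{A}$ with $P_M(x)\subset D$. *)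

theory Defs
  imports "HOL-Probability.Probability"
begin

section \<open>The circle and the annulus\<close>

quotient_type circle = real / "\<lambda>x y :: real. x - y \<in> \<int>"
  morphisms circle_rep circle_of
proof (rule equivpI)
  show "reflp (\<lambda>x y :: real. x - y \<in> \<int>)"
    by (simp add: reflp_def)
  show "symp (\<lambda>x y :: real. x - y \<in> \<int>)"
  proof (rule sympI)
    fix x y :: real
    assume "x - y \<in> \<int>"
    then have "- (x - y) \<in> \<int>"
      by (rule Ints_minus)
    then show "y - x \<in> \<int>"
      by simp
  qed
  show "transp (\<lambda>x y :: real. x - y \<in> \<int>)"
  proof (rule transpI)
    fix x y z :: real
    assume "x - y \<in> \<int>" "y - z \<in> \<int>"
    then have "(x - y) + (y - z) \<in> \<int>"
      by (rule Ints_add)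
    then show "x - z \<in> \<int>"
      by simp
  qed
qed

text \<open>The lift of \<^term>\<open>s - t\<close> that lies in \<^term>\<open>{-1/2..<1/2 :: real}\<close>
  (\<^term>\<open>round\<close> rounds half-integers up).\<close>

lift_definition circle_diff :: "circle \<Rightarrow> circle \<Rightarrow> real"
  is "\<lambda>s t. (s - t) - of_int (round (s - t))"
proof -
  fix s s' t t' :: real
  assume "s - s' \<in> \<int>" "t - t' \<in> \<int>"
  then obtain k l :: int where "s - s' = of_int k" "t - t' = of_int l"
    by (auto elim!: Ints_cases)
  then have eq: "s - t = (s' - t') + of_int (k - l)"
    by simp
  show "(s - t) - of_int (round (s - t)) = (s' - t') - of_int (round (s' - t'))"
  proof -
    have "round ((s' - t') + of_int (k - l)) = round (s' - t') + (k - l)"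
      unfolding round_def by linarith
    then show ?thesis
      by (simp add: eq)
  qed
qed

lemma circle_of_surj: obtains x where "s = circle_of x"
  using Quotient_abs_rep[OF Quotient_circle, of s] by metis

lemma circle_diff_circle_of:
  "circle_diff (circle_of x) (circle_of y) = x - y - of_int (round (x - y))"
  by (rule circle_diff.abs_eq)

lemma circle_of_eq_iff: "circle_of x = circle_of y \<longleftrightarrow> x - y \<in> \<int>"
  by (rule circle.abs_eq_iff)

lemma circle_diff_bounds: "circle_diff s t \<in> {-1/2..<1/2}"
proof -
  obtain x y where "s = circle_of x" "t = circle_of y"
    by (metis circle_of_surj)
  moreover have "- 1/2 \<le> u - of_int (round u)" "u - of_int (round u) < 1/2" for u :: real
    unfolding round_def by linarith+
  ultimately show ?thesis
    by (simp only: circle_diff_circle_of atLeastLessThan_iff)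
qed

lemma abs_circle_diff_le:
  "\<bar>circle_diff (circle_of x) (circle_of y)\<bar> \<le> \<bar>x - y - of_int k\<bar>"
  unfolding circle_diff_circle_of by (rule round_diff_minimal)

lemma circle_of_circle_diff: "circle_of (y + circle_diff s (circle_of y)) = s"
proof -
  obtain x where "s = circle_of x"
    by (rule circle_of_surj)
  then show ?thesis
    by (simp add: circle_diff_circle_of circle_of_eq_iff)
qed

instantiation circle :: metric_space
begin

definition dist_circle :: "circle \<Rightarrow> circle \<Rightarrow> real"
  where "dist_circle s t = \<bar>circle_diff s t\<bar>"

definition uniformity_circle :: "(circle \<times> circle) filter"
  where "uniformity_circle = (INF e\<in>{0 <..}. principal {(s, t). dist s t < e})"

definition open_circle :: "circle set \<Rightarrow> bool"
  where "open_circle U \<longleftrightarrow> (\<forall>s\<in>U. eventually (\<lambda>(s', t). s' = s \<longrightarrow> t \<in> U) uniformity)"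

instance
proof
  fix a b c :: circle
  obtain x y z where xyz: "a = circle_of x" "b = circle_of y" "c = circle_of z"
    by (metis circle_of_surj)
  show "dist a b = 0 \<longleftrightarrow> a = b"
  proof
    assume "dist a b = 0"
    then have "circle_diff a b = 0"
      by (simp add: dist_circle_def)
    then show "a = b"
      using circle_of_circle_diff[of y a] by (simp only: xyz add_0_right)
  next
    assume "a = b"
    then show "dist a b = 0"
      by (simp add: dist_circle_def xyz circle_diff_circle_of)
  qed
  let ?m = "round (x - z)" and ?n = "round (y - z)"
  have "dist a b \<le> \<bar>x - y - of_int (?m - ?n)\<bar>"
    unfolding dist_circle_def xyz by (rule abs_circle_diff_le)
  also have "x - y - of_int (?m - ?n) = (x - z - of_int ?m) - (y - z - of_int ?n)"
    by simp
  also have "\<bar>\<dots>\<bar> \<le> \<bar>x - z - of_int ?m\<bar> + \<bar>y - z - of_int ?n\<bar>"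
    by (rule abs_triangle_ineq4)
  also have "\<dots> = dist a c + dist b c"
    by (simp only: dist_circle_def xyz circle_diff_circle_of)
  finally show "dist a b \<le> dist a c + dist b c" .
qed (fact uniformity_circle_def open_circle_def)+

end

text \<open>The metric topology of the circle is the quotient topology.\<close>

lemma open_circle_iff: "open U \<longleftrightarrow> open (circle_of -` U)"
proof
  assume U: "open U"
  show "open (circle_of -` U)"
    unfolding open_dist
  proof
    fix x assume "x \<in> circle_of -` U"
    then obtain e where e: "e > 0" "\<And>t. dist t (circle_of x) < e \<Longrightarrow> t \<in> U"
      using U unfolding open_dist vimage_eq by metis
    have "y \<in> circle_of -` U" if "dist y x < e" for y
      using e(2)[of "circle_of y"] abs_circle_diff_le[of y x 0] that
      by (simp add: dist_circle_def dist_real_def)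
    with e(1) show "\<exists>e>0. \<forall>y. dist y x < e \<longrightarrow> y \<in> circle_of -` U"
      by blast
  qed
next
  assume U: "open (circle_of -` U)"
  show "open U"
    unfolding open_dist
  proof
    fix s assume "s \<in> U"
    obtain x where x: "s = circle_of x"
      by (rule circle_of_surj)
    with \<open>s \<in> U\<close> have "x \<in> circle_of -` U"
      by simp
    then obtain e where e: "e > 0" "\<And>y. dist y x < e \<Longrightarrow> circle_of y \<in> U"
      using U unfolding open_dist vimage_def by auto
    have "t \<in> U" if "dist t s < e" for t
    proof -
      have "dist (x + circle_diff t s) x < e"
        using that by (simp add: dist_circle_def dist_real_def)
      from e(2)[OF this] show ?thesis
        by (simp only: x circle_of_circle_diff)
    qed
    with e(1) show "\<exists>e>0. \<forall>t. dist t s < e \<longrightarrow> t \<in> U"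
      by blast
  qed
qed

text \<open>The product metric of \<^typ>\<open>circle \<times> real\<close> is the distance of the flat Riemannian
  metric.\<close>

type_synonym annulus = "circle \<times> real"

definition annulus_proj :: "real \<times> real \<Rightarrow> annulus"
  where "annulus_proj z = (circle_of (fst z), snd z)"

definition annulus_lift :: "(annulus \<Rightarrow> annulus) \<Rightarrow> (real \<times> real \<Rightarrow> real \<times> real) \<Rightarrow> bool"
  where "annulus_lift f F \<longleftrightarrow>
    continuous_on UNIV F \<and> (\<forall>z. annulus_proj (F z) = f (annulus_proj z))"


section \<open>Exact symplectic twist maps\<close>

definition C1_map :: "('a::real_normed_vector \<Rightarrow> 'b::real_normed_vector) \<Rightarrow> bool"
  where "C1_map g \<longleftrightarrow> (\<exists>g' :: 'a \<Rightarrow> 'a \<Rightarrow>\<^sub>L 'b.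
    (\<forall>x. (g has_derivative blinfun_apply (g' x)) (at x)) \<and> continuous_on UNIV g')"

definition C1_diffeo :: "('a::real_normed_vector \<Rightarrow> 'b::real_normed_vector) \<Rightarrow> bool"
  where "C1_diffeo g \<longleftrightarrow> bij g \<and> C1_map g \<and> C1_map (inv g)"

text \<open>The differentiable structure of the annulus is the one for which \<^const>\<open>annulus_proj\<close> is a
  local diffeomorphism. As the plane is simply connected, every continuous self-map of the annulus
  has a lift, so smoothness can be read off a global lift.\<close>

definition annulus_C1_map :: "(annulus \<Rightarrow> annulus) \<Rightarrow> bool"
  where "annulus_C1_map f \<longleftrightarrow> (\<exists>F. annulus_lift f F \<and> C1_map F)"

definition annulus_C1_diffeo :: "(annulus \<Rightarrow> annulus) \<Rightarrow> bool"
  where "annulus_C1_diffeo f \<longleftrightarrow> bij f \<and> annulus_C1_map f \<and> annulus_C1_map (inv f)"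

definition isotopic_to_id :: "(annulus \<Rightarrow> annulus) \<Rightarrow> bool"
  where "isotopic_to_id f \<longleftrightarrow>
    homotopic_with (homeomorphic_map euclidean euclidean) euclidean euclidean id f"

definition positive_twist_map :: "(annulus \<Rightarrow> annulus) \<Rightarrow> bool"
  where "positive_twist_map f \<longleftrightarrow> annulus_C1_diffeo f \<and> isotopic_to_id f \<and>
    (\<forall>F \<theta>. annulus_lift f F \<longrightarrow>
      C1_diffeo (\<lambda>r. fst (F (\<theta>, r))) \<and> strict_mono (\<lambda>r. fst (F (\<theta>, r))) \<and>
      C1_diffeo (\<lambda>r. fst (inv F (\<theta>, r))) \<and> monotone (<) (>) (\<lambda>r. fst (inv F (\<theta>, r))))"

definition negative_twist_map :: "(annulus \<Rightarrow> annulus) \<Rightarrow> bool"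
  where "negative_twist_map f \<longleftrightarrow> (\<exists>g. positive_twist_map g \<and> f = inv g)"

definition twist_map :: "(annulus \<Rightarrow> annulus) \<Rightarrow> bool"
  where "twist_map f \<longleftrightarrow> positive_twist_map f \<or> negative_twist_map f"

text \<open>Every tangent space of the annulus is identified with \<^typ>\<open>real \<times> real\<close> by the differential
  of \<^const>\<open>annulus_proj\<close>; the result does not depend on the lift nor on the point above
  \<^term>\<open>x\<close>.\<close>

definition annulus_deriv :: "(annulus \<Rightarrow> annulus) \<Rightarrow> annulus \<Rightarrow> real \<times> real \<Rightarrow> real \<times> real"
  where "annulus_deriv f x = (THE L. \<exists>F z. annulus_lift f F \<and> annulus_proj z = x \<and>
    (F has_derivative L) (at z))"

text \<open>At \<^term>\<open>x = (\<theta>, r)\<close> the form \<open>f\<^sup>*(r d\<theta>) - r d\<theta>\<close> takes the value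
  \<^term>\<open>snd (f x) * fst (annulus_deriv f x v) - snd x * fst v\<close> on the vector \<^term>\<open>v\<close>.\<close>

definition exact_symplectic :: "(annulus \<Rightarrow> annulus) \<Rightarrow> bool"
  where "exact_symplectic f \<longleftrightarrow> (\<exists>S :: annulus \<Rightarrow> real. \<forall>z.
    ((\<lambda>w. S (annulus_proj w)) has_derivative
      (\<lambda>v. snd (f (annulus_proj z)) * fst (annulus_deriv f (annulus_proj z) v) - snd z * fst v))
    (at z))"


section \<open>Aubry-Mather sets\<close>

definition ordered_set :: "(annulus \<Rightarrow> annulus) \<Rightarrow> annulus set \<Rightarrow> bool"
  where "ordered_set f M \<longleftrightarrow> M \<noteq> {} \<and> compact M \<and> f ` M = M \<and>
    (\<forall>F. annulus_lift f F \<longrightarrow>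
      (\<forall>z \<in> annulus_proj -` M. \<forall>z' \<in> annulus_proj -` M.
        fst z < fst z' \<longleftrightarrow> fst (F z) < fst (F z')))"

definition aubry_mather_set :: "(annulus \<Rightarrow> annulus) \<Rightarrow> annulus set \<Rightarrow> bool"
  where "aubry_mather_set f M \<longleftrightarrow>
    ordered_set f M \<and> (\<forall>N. ordered_set f N \<and> N \<subseteq> M \<longrightarrow> N = M)"

definition circle_lift :: "(circle \<Rightarrow> circle) \<Rightarrow> (real \<Rightarrow> real) \<Rightarrow> bool"
  where "circle_lift h H \<longleftrightarrow>
    continuous_on UNIV H \<and> (\<forall>x. circle_of (H x) = h (circle_of x))"

definition orientation_preserving_homeo :: "(circle \<Rightarrow> circle) \<Rightarrow> bool"
  where "orientation_preserving_homeo h \<longleftrightarrow>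
    homeomorphic_map euclidean euclidean h \<and> (\<exists>H. circle_lift h H \<and> strict_mono H)"

definition has_rotation_number :: "(real \<Rightarrow> real) \<Rightarrow> real \<Rightarrow> bool"
  where "has_rotation_number H \<rho> \<longleftrightarrow>
    (\<forall>x. (\<lambda>n. ((H ^^ n) x - x) / real n) \<longlonglongrightarrow> \<rho>)"

definition AM_rotation_number ::
    "(annulus \<Rightarrow> annulus) \<Rightarrow> annulus set \<Rightarrow> (real \<times> real \<Rightarrow> real \<times> real) \<Rightarrow> real \<Rightarrow> bool"
  where "AM_rotation_number f M F \<rho> \<longleftrightarrow> (\<exists>h H.
    orientation_preserving_homeo h \<and> (\<forall>x\<in>M. fst (f x) = h (fst x)) \<and>
    circle_lift h H \<and> (\<forall>z \<in> annulus_proj -` M. H (fst z) = fst (F z)) \<and>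
    has_rotation_number H \<rho>)"

text \<open>Two lifts of \<^term>\<open>f\<close> differ by an integer translation, so irrationality does not depend on
  the lift.\<close>

definition irrational_AM_set :: "(annulus \<Rightarrow> annulus) \<Rightarrow> annulus set \<Rightarrow> bool"
  where "irrational_AM_set f M \<longleftrightarrow> aubry_mather_set f M \<and>
    (\<exists>F \<rho>. annulus_lift f F \<and> AM_rotation_number f M F \<rho> \<and> \<rho> \<notin> \<rat>)"


section \<open>Paratingent cones\<close>

text \<open>Since \<^term>\<open>x\<close> and \<^term>\<open>y\<close> will be close to each other, the second component, which needs
  no lifting, is automatically in \<^term>\<open>{-1/2..<1/2 :: real}\<close>.\<close>

definition annulus_diff :: "annulus \<Rightarrow> annulus \<Rightarrow> real \<times> real"
  where "annulus_diff x y = (circle_diff (fst x) (fst y), snd x - snd y)"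

definition paratingent_cone :: "annulus set \<Rightarrow> annulus \<Rightarrow> (real \<times> real) set"
  where "paratingent_cone M x = {v. \<exists>X Y (t :: nat \<Rightarrow> real).
    (\<forall>n. X n \<in> M) \<and> (\<forall>n. Y n \<in> M) \<and> X \<longlonglongrightarrow> x \<and> Y \<longlonglongrightarrow> x \<and>
    (\<forall>n. t n > 0) \<and> t \<longlonglongrightarrow> 0 \<and>
    (\<lambda>n. annulus_diff (X n) (Y n) /\<^sub>R t n) \<longlonglongrightarrow> v}"

definition C1_regular_at :: "annulus set \<Rightarrow> annulus \<Rightarrow> bool"
  where "C1_regular_at M x \<longleftrightarrow> (\<exists>D. subspace D \<and> dim D = 1 \<and> paratingent_cone M x \<subseteq> D)"


section \<open>Invariant measures and Lyapunov exponents\<close>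

text \<open>An Aubry-Mather set \<^term>\<open>M\<close> carries exactly one such measure \<^term>\<open>\<mu>\<close>, which is then
  ergodic.\<close>

definition invariant_borel_probability ::
    "(annulus \<Rightarrow> annulus) \<Rightarrow> annulus set \<Rightarrow> annulus measure \<Rightarrow> bool"
  where "invariant_borel_probability f M \<mu> \<longleftrightarrow>
    sets \<mu> = sets borel \<and> prob_space \<mu> \<and> distr \<mu> \<mu> f = \<mu> \<and> emeasure \<mu> M = 1"

text \<open>By the chain rule, the cocycle generated by the derivative of \<^term>\<open>f\<close> is the derivative of
  \<^term>\<open>f ^^ n\<close>.\<close>

definition has_lyapunov_exponent ::
    "(annulus \<Rightarrow> annulus) \<Rightarrow> annulus \<Rightarrow> real \<times> real \<Rightarrow> real \<Rightarrow> bool"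
  where "has_lyapunov_exponent f x v \<kappa> \<longleftrightarrow>
    (\<lambda>n. ln (norm (annulus_deriv (f ^^ n) x v)) / real n) \<longlonglongrightarrow> \<kappa>"

text \<open>\<^term>\<open>E\<close> is the set of Lyapunov exponents of \<^term>\<open>\<mu>\<close>: at almost every point the Lyapunov
  exponents of all non-zero vectors exist and form the set \<^term>\<open>E\<close>. For an ergodic \<^term>\<open>\<mu>\<close> such
  a set exists by the theorem of Oseledets, and it is unique.\<close>

definition has_lyapunov_exponents ::
    "(annulus \<Rightarrow> annulus) \<Rightarrow> annulus measure \<Rightarrow> real set \<Rightarrow> bool"
  where "has_lyapunov_exponents f \<mu> E \<longleftrightarrow> (AE x in \<mu>.
    (\<forall>v. v \<noteq> 0 \<longrightarrow> (\<exists>\<kappa>\<in>E. has_lyapunov_exponent f x v \<kappa>)) \<and>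
    (\<forall>\<kappa>\<in>E. \<exists>v. v \<noteq> 0 \<and> has_lyapunov_exponent f x v \<kappa>))"

end

theory Submission
  imports Defs "HOL-Analysis.Kronecker_Approximation_Theorem"
begin

text \<open>At each point \<open>x\<close> of \<open>M\<close> regularity gives a line containing the paratingent cone; these lines form
  a \<open>Df\<close>-invariant field, and \<open>dist (f a) (f b) / dist a b\<close> tends to the stretch \<open>\<bar>c x\<bar>\<close> of \<open>Df\<close> on
  the line when \<open>a \<noteq> b\<close> in \<open>M\<close> tend to \<open>x\<close>. So \<open>\<phi> = ln \<bar>c\<bar>\<close> is continuous on \<open>M\<close>.
  As \<open>M\<close> projects injectively to the circle, where \<open>f\<close> acts with irrational rotation number, the Birkhoff
  averages of \<open>\<phi>\<close> converge uniformly to a constant. Were it not zero, an iterate of \<open>f\<close> or of its inverse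
  would contract small distances in the infinite compact set \<open>M\<close>, which is impossible. Hence \<open>Df\<^sup>n\<close> neither
  grows nor decays exponentially on the line field, nor, since it preserves area, in any other direction.\<close>

section \<open>Lifts to the universal covering\<close>

text \<open>The paratingent cone lets both end points of a secant move, and strict differentiability
  of a C1 map matches this. The ratio of distances is thus a function of pairs with a limit at the
  diagonal, and continuity of that limit requires no continuity of the unit vectors chosen on the
  lines. It does require every point of \<open>M\<close> to be a limit point, which minimality
  supplies. The projection of \<open>M\<close> may be a Cantor set, where the circle map is in
  general only semiconjugate to a rotation. Visits to arcs are therefore counted by integer parts
  and compared with the rotation by squeezing between points of one orbit. The mean of \<phi> is
  never identified as an integral, only as a number that is independent of the point up to
  \<epsilon>. The exponents are computed at every point of \<open>M\<close>; \<open>\<mu>\<close>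
  enters through the full measure of \<open>M\<close>.\<close>

lemma continuous_circle_of [continuous_intros]:
  "continuous_on A g \<Longrightarrow> continuous_on A (\<lambda>x. circle_of (g x))"
proof -
  have "continuous_on UNIV circle_of"
    by (rule continuous_on_open_vimage[THEN iffD2, OF open_UNIV]) (auto simp: open_circle_iff)
  then show "continuous_on A g \<Longrightarrow> continuous_on A (\<lambda>x. circle_of (g x))"
    by (rule continuous_on_compose2) auto
qed

lemma continuous_annulus_proj: "continuous_on A annulus_proj"
  unfolding annulus_proj_def by (intro continuous_intros)

lemma circle_of_add_of_int [simp]: "circle_of (x + of_int k) = circle_of x"
  by (simp add: circle_of_eq_iff)

lemma annulus_proj_surj: obtains z where "x = annulus_proj z"
proof -
  obtain t where "fst x = circle_of t" by (rule circle_of_surj)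
  then have "x = annulus_proj (t, snd x)" by (simp add: annulus_proj_def prod_eq_iff)
  then show ?thesis by (rule that)
qed

lemma annulus_proj_eq_iff:
  "annulus_proj z = annulus_proj w \<longleftrightarrow> fst z - fst w \<in> \<int> \<and> snd z = snd w"
  by (simp add: annulus_proj_def circle_of_eq_iff)

lemma annulus_proj_eqE:
  assumes "annulus_proj z = annulus_proj w"
  obtains k :: int where "z = w + (of_int k, 0)"
proof -
  obtain k :: int where "fst z - fst w = of_int k" "snd z = snd w"
    using assms by (auto simp: annulus_proj_eq_iff elim!: Ints_cases)
  then have "z = w + (of_int k, 0)" by (simp add: prod_eq_iff)
  then show ?thesis by (rule that)
qed

lemma annulus_proj_shift [simp]: "annulus_proj (z + (of_int k, 0)) = annulus_proj z"
  by (simp add: annulus_proj_def)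

lemma annulus_proj_add_diff: "annulus_proj (z + annulus_diff x (annulus_proj z)) = x"
  by (simp add: annulus_proj_def annulus_diff_def circle_of_circle_diff prod_eq_iff)

lemma norm_annulus_diff: "norm (annulus_diff x y) = dist x y"
  by (simp add: annulus_diff_def norm_prod_def dist_prod_def dist_circle_def dist_real_def)

lemma annulus_diff_proj:
  assumes "\<bar>fst z - fst w\<bar> < 1/2"
  shows "annulus_diff (annulus_proj z) (annulus_proj w) = z - w"
proof -
  have "round (fst z - fst w) = 0"
    using assms unfolding round_def by linarith
  then show ?thesis
    by (simp add: annulus_diff_def annulus_proj_def circle_diff_circle_of prod_eq_iff)
qed

lemma annulus_diff_tendsto_0:
  assumes "X \<longlonglongrightarrow> x" "Y \<longlonglongrightarrow> x"
  shows "(\<lambda>n. annulus_diff (X n) (Y n)) \<longlonglongrightarrow> 0"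
proof -
  have "(\<lambda>n. dist (X n) (Y n)) \<longlonglongrightarrow> dist x x"
    by (intro tendsto_intros assms)
  then show ?thesis
    by (simp add: norm_annulus_diff[symmetric] tendsto_norm_zero_iff)
qed

lemma annulus_lift_proj: "annulus_lift f F \<Longrightarrow> annulus_proj (F z) = f (annulus_proj z)"
  unfolding annulus_lift_def by blast

lemma annulus_lift_cont: "annulus_lift f F \<Longrightarrow> continuous_on A F"
  unfolding annulus_lift_def by (blast intro: continuous_on_subset)

lemma annulus_liftI:
  "continuous_on UNIV F \<Longrightarrow> (\<And>z. annulus_proj (F z) = f (annulus_proj z)) \<Longrightarrow> annulus_lift f F"
  unfolding annulus_lift_def by blast

text \<open>A sequence converging in the annulus lifts to a convergent sequence in the plane: add
  its differences from the limit to a fixed point above the limit. So continuity of \<open>F\<close>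
  descends.\<close>

lemma annulus_lift_continuous:
  assumes "annulus_lift f F"
  shows "continuous_on A f"
proof -
  have "isCont f x" for x
    unfolding continuous_within_sequentially o_def
  proof (intro allI impI)
    fix X assume X: "(\<forall>n. X n \<in> UNIV) \<and> X \<longlonglongrightarrow> x"
    obtain z where z: "x = annulus_proj z" by (rule annulus_proj_surj)
    define Z where "Z n = z + annulus_diff (X n) x" for n
    have pZ: "annulus_proj (Z n) = X n" for n
      by (simp add: Z_def z annulus_proj_add_diff)
    have "Z \<longlonglongrightarrow> z + 0"
      unfolding Z_def using X by (intro tendsto_intros annulus_diff_tendsto_0[of X x]) auto
    moreover have "continuous_on UNIV (\<lambda>w. annulus_proj (F w))"
      by (intro continuous_on_compose2[OF continuous_annulus_proj[of UNIV]] annulus_lift_cont[OF assms]) auto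
    ultimately have "(\<lambda>n. annulus_proj (F (Z n))) \<longlonglongrightarrow> annulus_proj (F z)"
      unfolding continuous_on_sequentially o_def add_0_right by blast
    then show "(\<lambda>n. f (X n)) \<longlonglongrightarrow> f x"
      by (simp add: annulus_lift_proj[OF assms] pZ z)
  qed
  then show ?thesis
    by (simp add: continuous_at_imp_continuous_on)
qed

lemma continuous_Ints_const:
  fixes g :: "'a::real_normed_vector \<Rightarrow> real"
  assumes "continuous_on UNIV g" "\<And>x. g x \<in> \<int>"
  obtains k :: int where "\<And>x. g x = of_int k"
proof -
  have "g constant_on UNIV"
  proof (rule continuous_discrete_range_constant)
    fix x
    show "\<exists>e>0. \<forall>y. y \<in> UNIV \<and> g y \<noteq> g x \<longrightarrow> e \<le> norm (g y - g x)"
    proof (intro exI[of _ 1] conjI allI impI)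
      fix y assume "y \<in> UNIV \<and> g y \<noteq> g x"
      then show "1 \<le> norm (g y - g x)"
        using Ints_nonzero_abs_ge1[of "g y - g x"] assms(2) by (auto intro: Ints_diff)
    qed simp
  qed (use assms in auto)
  then obtain c where "\<And>x. g x = c" by (auto simp: constant_on_def)
  moreover from this obtain k where "c = of_int k" using assms(2)[of 0] by (auto elim: Ints_cases)
  ultimately show ?thesis using that by auto
qed

lemma annulus_lift_unique:
  assumes "annulus_lift f F" "annulus_lift f G"
  obtains k :: int where "\<And>w. G w = F w + (of_int k, 0)"
proof -
  have *: "annulus_proj (G w) = annulus_proj (F w)" for w
    using assms by (simp add: annulus_lift_proj)
  have "fst (G w) - fst (F w) \<in> \<int>" and s: "snd (G w) = snd (F w)" for w
    using *[of w] by (auto simp: annulus_proj_eq_iff)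
  moreover have "continuous_on UNIV (\<lambda>w. fst (G w) - fst (F w))"
    using assms by (intro continuous_intros annulus_lift_cont)
  ultimately obtain k :: int where "\<And>w. fst (G w) - fst (F w) = of_int k"
    using continuous_Ints_const by blast
  then have "G w = F w + (of_int k, 0)" for w
    using s[of w] by (auto simp: prod_eq_iff algebra_simps)
  then show ?thesis by (rule that)
qed

text \<open>The definite description is well defined because any competing lift and base point
  differ from \<open>G\<close> and \<open>z\<close> by integer translations after and before the
  map, and these have the identity as derivative.\<close>

lemma annulus_deriv_eq:
  assumes G: "annulus_lift g G" and L: "(G has_derivative L) (at z)"
  shows "annulus_deriv g (annulus_proj z) = L"
  unfolding annulus_deriv_def
proof (rule the_equality)
  show "\<exists>F w. annulus_lift g F \<and> annulus_proj w = annulus_proj z \<and> (F has_derivative L) (at w)"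
    using assms by blast
next
  fix L' assume "\<exists>F w. annulus_lift g F \<and> annulus_proj w = annulus_proj z \<and> (F has_derivative L') (at w)"
  then obtain F w where F: "annulus_lift g F" and w: "annulus_proj w = annulus_proj z"
    and L': "(F has_derivative L') (at w)" by blast
  obtain k :: int where k: "w = z + (of_int k, 0)" using w by (rule annulus_proj_eqE)
  let ?s = "\<lambda>v::real\<times>real. v + (of_int k, 0)"
  have "annulus_lift g (\<lambda>v. F (?s v))"
  proof (rule annulus_liftI)
    show "continuous_on UNIV (\<lambda>v. F (?s v))"
      by (rule continuous_on_compose2[OF annulus_lift_cont[OF F, of UNIV]]) (auto intro!: continuous_intros)
  qed (simp add: annulus_lift_proj[OF F])
  with G obtain j :: int where j: "\<And>v. F (?s v) = G v + (of_int j, 0)"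
    using annulus_lift_unique by blast
  have "((\<lambda>v. F (?s v)) has_derivative (\<lambda>v. L' v)) (at z)"
    by (rule has_derivative_compose[of ?s "\<lambda>v. v" z UNIV F L', simplified])
       (use L' k in \<open>auto intro!: derivative_eq_intros\<close>)
  moreover have "((\<lambda>v. F (?s v)) has_derivative L) (at z)"
    unfolding j by (auto intro!: derivative_eq_intros L)
  ultimately show "L' = L" by (rule has_derivative_unique)
qed

lemma annulus_lift_funpow: "annulus_lift f F \<Longrightarrow> annulus_lift (f ^^ n) (F ^^ n)"
proof (induction n)
  case 0 then show ?case by (simp add: annulus_lift_def id_def)
next
  case (Suc n)
  have "continuous_on UNIV (\<lambda>z. F ((F ^^ n) z))"
    by (rule continuous_on_compose2[OF annulus_lift_cont annulus_lift_cont]) (use Suc in auto)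
  then show ?case
    using Suc by (intro annulus_liftI) (auto simp: annulus_lift_proj o_def simp del: split_paired_All)
qed

section \<open>Exact symplectic maps preserve area\<close>

definition area_form :: "real \<times> real \<Rightarrow> real \<times> real \<Rightarrow> real"
  where "area_form v w = fst v * snd w - snd v * fst w"

lemma linear_plane:
  fixes L :: "real \<times> real \<Rightarrow> 'a::real_vector"
  assumes "linear L"
  shows "L v = fst v *\<^sub>R L (1, 0) + snd v *\<^sub>R L (0, 1)"
proof -
  have "v = fst v *\<^sub>R (1, 0) + snd v *\<^sub>R (0, 1)" by (simp add: prod_eq_iff)
  then have "L v = L (fst v *\<^sub>R (1, 0) + snd v *\<^sub>R (0, 1))" by simp
  then show ?thesis
    by (simp only: linear_add[OF assms] linear_scale[OF assms])
qed

text \<open>The factor is the determinant of \<open>L\<close>.\<close>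

lemma area_form_linear:
  assumes "linear L"
  shows "area_form (L v) (L w) = area_form (L (1, 0)) (L (0, 1)) * area_form v w"
  unfolding area_form_def
  by (subst (1 2 3 4) linear_plane[OF assms]) (simp add: algebra_simps)

lemma abs_fst_snd_le_norm:
  fixes v :: "real \<times> real"
  shows "\<bar>fst v\<bar> \<le> norm v" "\<bar>snd v\<bar> \<le> norm v"
  using norm_fst_le[of "fst v" "snd v"] norm_snd_le[of "snd v" "fst v"] by simp_all

text \<open>Rolle's theorem on small circles around \<open>z\<close> replaces Stokes' theorem here: \<open>F\<close> being only
  \<open>C\<^sup>1\<close>, the form \<open>F\<^sup>*(r d\<theta>)\<close> cannot be differentiated. Subtracting the symmetric part \<open>q\<close> of its
  linearization at \<open>z\<close> leaves an exact form that is \<open>(1 - det L) / 2\<close> times the angular form up to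
  higher order, and it vanishes somewhere on each circle.\<close>

lemma exact_form_imp_area_form:
  fixes F :: "real \<times> real \<Rightarrow> real \<times> real" and F' :: "real \<times> real \<Rightarrow> (real \<times> real) \<Rightarrow>\<^sub>L (real \<times> real)"
  assumes F: "\<And>w. (F has_derivative blinfun_apply (F' w)) (at w)"
    and cont: "isCont F' z"
    and S: "\<And>w. (S has_derivative (\<lambda>v. snd (F w) * fst (F' w v) - snd w * fst v)) (at w)"
  shows "area_form (F' z v) (F' z w) = area_form v w"
proof -
  define a b c d where "a = fst (F' z (1, 0))" and "b = fst (F' z (0, 1))"
    and "c = snd (F' z (1, 0))" and "d = snd (F' z (0, 1))"
  have lin: "linear (blinfun_apply (F' z))" by (rule bounded_linear.linear[OF blinfun.bounded_linear_right])
  have L: "F' z v = (a * fst v + b * snd v, c * fst v + d * snd v)" for v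
    by (subst linear_plane[OF lin]) (simp add: a_def b_def c_def d_def prod_eq_iff)
  define C where "C = \<bar>a\<bar> + \<bar>b\<bar> + \<bar>c\<bar> + \<bar>d\<bar>"
  \<comment> \<open>\<open>\<eta>\<close> controls both the linearization error of \<open>F\<close>
    near \<open>z\<close> and the variation of \<open>F'\<close>. Only the limit 0 of the right-hand
    side matters, so its constants are generous.\<close>
  have bound: "\<bar>a * d - b * c - 1\<bar> \<le> 4 * \<eta> * (2 * C + \<eta>)" if \<eta>: "\<eta> > 0" for \<eta>
  proof -
    from F[of z] \<eta> obtain \<delta>1 where \<delta>1: "\<delta>1 > 0"
      "\<And>y. norm (y - z) < \<delta>1 \<Longrightarrow> norm (F y - F z - F' z (y - z)) \<le> \<eta> * norm (y - z)"
      unfolding has_derivative_at_alt by blast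
    from cont \<eta> obtain \<delta>2 where \<delta>2: "\<delta>2 > 0" "\<And>y. dist y z < \<delta>2 \<Longrightarrow> dist (F' y) (F' z) < \<eta>"
      unfolding continuous_at_eps_delta by blast
    define \<epsilon> where "\<epsilon> = min \<delta>1 \<delta>2 / 2"
    have \<epsilon>: "\<epsilon> > 0" "\<epsilon> < \<delta>1" "\<epsilon> < \<delta>2" using \<delta>1(1) \<delta>2(1) by (auto simp: \<epsilon>_def min_def)
    define e e' where "e t = (cos t, sin t)" and "e' t = (- sin t, cos t)" for t :: real
    define p where "p t = z + \<epsilon> *\<^sub>R e t" for t
    \<comment> \<open>\<open>q t\<close> is the product of the coordinates of
      \<open>F' z (e t)\<close> minus that of the coordinates of \<open>e t\<close>. As
      \<open>r d\<theta>\<close> has symmetric part half the differential of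
      \<open>\<theta> * r\<close>, \<open>\<epsilon>\<^sup>2 / 2 * q\<close> is a primitive of the
      symmetric part along the circle.\<close>
    define q where "q t = (c * cos t + d * sin t) * (a * cos t + b * sin t) - sin t * cos t" for t :: real
    define q' where "q' t = (- c * sin t + d * cos t) * (a * cos t + b * sin t)
      + (c * cos t + d * sin t) * (- a * sin t + b * cos t) - (cos t * cos t - sin t * sin t)" for t :: real
    \<comment> \<open>The terms with \<open>snd (F z)\<close> and \<open>snd z\<close> recentre both
      forms at \<open>z\<close>, which makes the derivative of \<open>G\<close> of second order in
      \<open>\<epsilon>\<close>.\<close>
    define G where "G t = S (p t) - snd (F z) * fst (F (p t)) + snd z * fst (p t) - \<epsilon>\<^sup>2 / 2 * q t" for t
    define G' where "G' t = \<epsilon> * ((snd (F (p t)) - snd (F z)) * fst (F' (p t) (e' t)))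
       - \<epsilon>\<^sup>2 * (sin t * - sin t) - \<epsilon>\<^sup>2 / 2 * q' t" for t
    have p': "(p has_derivative (\<lambda>h. (h * \<epsilon>) *\<^sub>R e' t)) (at t)" for t
      unfolding p_def e_def e'_def
      by (auto intro!: derivative_eq_intros simp: fun_eq_iff)
    have G': "(G has_field_derivative G' t) (at t)" for t
    proof -
      have 1: "((\<lambda>t. S (p t)) has_derivative (\<lambda>h. snd (F (p t)) * fst (F' (p t) ((h * \<epsilon>) *\<^sub>R e' t))
          - snd (p t) * fst ((h * \<epsilon>) *\<^sub>R e' t))) (at t)"
        by (rule has_derivative_compose[OF p' S])
      have 2: "((\<lambda>t. F (p t)) has_derivative (\<lambda>h. F' (p t) ((h * \<epsilon>) *\<^sub>R e' t))) (at t)"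
        by (rule has_derivative_compose[OF p' F])
      have q: "(q has_field_derivative q' t) (at t)"
        unfolding q_def q'_def by (auto intro!: derivative_eq_intros simp: algebra_simps)
      have e'1: "fst (e' t) = - sin t" and p2: "snd (p t) = snd z + \<epsilon> * sin t"
        by (simp_all add: e'_def p_def e_def)
      show ?thesis
        unfolding has_field_derivative_def G_def
        by (rule has_derivative_eq_rhs[OF has_derivative_diff[OF has_derivative_add[OF
              has_derivative_diff[OF 1 has_derivative_mult_right[OF has_derivative_fst[OF 2]]]
              has_derivative_mult_right[OF has_derivative_fst[OF p']]]
              has_derivative_mult_right[OF q[unfolded has_field_derivative_def]]]])
          (simp add: fun_eq_iff G'_def blinfun.scaleR_right p2 e'1 power2_eq_square algebra_simps)
    qed
    have "\<exists>t. 0 < t \<and> t < 2 * pi \<and> (*) (G' t) = (\<lambda>v. 0)"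
    proof (rule Rolle_deriv)
      show "G 0 = G (2 * pi)" by (simp add: G_def p_def e_def q_def)
      show "continuous_on {0..2 * pi} G" using G' by (meson DERIV_continuous_on has_field_derivative_at_within)
    qed (use G' in \<open>auto simp: has_field_derivative_def\<close>)
    then obtain t where "(*) (G' t) = (\<lambda>v. 0)" by blast
    then have t: "G' t = 0" by (metis mult_1_right)
    have pz: "p t - z = \<epsilon> *\<^sub>R e t" "norm (p t - z) = \<epsilon>"
    proof -
      show 1: "p t - z = \<epsilon> *\<^sub>R e t" by (simp add: p_def)
      show "norm (p t - z) = \<epsilon>"
        unfolding 1 norm_scaleR using \<epsilon>(1) by (simp add: e_def norm_prod_def)
    qed
    define A where "A = (snd (F (p t)) - snd (F z)) / \<epsilon>"
    define B where "B = fst (F' (p t) (e' t))"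
    have A: "\<bar>A - (c * cos t + d * sin t)\<bar> \<le> \<eta>"
    proof -
      have "\<bar>snd (F (p t) - F z - F' z (p t - z))\<bar> \<le> \<eta> * \<epsilon>"
        using order_trans[OF abs_fst_snd_le_norm(2) \<delta>1(2)[of "p t"]] \<epsilon>(2) unfolding pz(2) by blast
      also have "snd (F (p t) - F z - F' z (p t - z)) = \<epsilon> * (A - (c * cos t + d * sin t))"
        unfolding L A_def pz(1) using \<epsilon>(1) by (simp add: e_def field_simps)
      finally show ?thesis using \<epsilon>(1) by (simp add: abs_mult)
    qed
    have B: "\<bar>B - (- a * sin t + b * cos t)\<bar> \<le> \<eta>"
    proof -
      have "\<bar>fst ((F' (p t) - F' z) (e' t))\<bar> \<le> norm ((F' (p t) - F' z) (e' t))"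
        by (rule abs_fst_snd_le_norm)
      also have "\<dots> \<le> norm (F' (p t) - F' z) * norm (e' t)" by (rule norm_blinfun)
      also have "\<dots> \<le> \<eta>"
        using \<delta>2(2)[of "p t"] \<epsilon> pz by (simp add: dist_norm e'_def norm_prod_def)
      finally show ?thesis by (simp add: B_def L blinfun.diff_left e'_def)
    qed
    define U V where "U = c * cos t + d * sin t" and "V = - a * sin t + b * cos t"
    have sc: "\<bar>x * cos t\<bar> \<le> \<bar>x\<bar>" "\<bar>x * sin t\<bar> \<le> \<bar>x\<bar>" for x :: real
      by (auto simp: abs_mult intro!: mult_left_le)
    have U: "\<bar>U\<bar> \<le> C" using sc(1)[of c] sc(2)[of d] by (auto simp: U_def C_def)
    have V: "\<bar>V\<bar> \<le> C" using sc(1)[of b] sc(2)[of "-a"] by (auto simp: V_def C_def)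
    have "0 = \<epsilon>\<^sup>2 * (A * B + sin t * sin t - q' t / 2)"
      using t \<epsilon>(1) by (simp add: G'_def A_def B_def power2_eq_square field_simps)
    then have "A * B + sin t * sin t - q' t / 2 = 0" using \<epsilon>(1) by simp
    \<comment> \<open>The antisymmetric part: the Wronskian of the two coordinates of
      \<open>F' z (e t)\<close> is \<open>a * d - b * c\<close>, because \<open>e t\<close> and
      \<open>e' t\<close> span unit area.\<close>
    moreover have "2 * (A * B - U * V) + (sin t * sin t + cos t * cos t) * (1 - (a * d - b * c))
        = 2 * (A * B + sin t * sin t) - q' t"
      unfolding q'_def U_def V_def by algebra
    ultimately have "2 * (A * B - U * V) + (sin t * sin t + cos t * cos t) * (1 - (a * d - b * c)) = 0"
      by simp
    then have "a * d - b * c - 1 = 2 * (A * B - U * V)"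
      using sin_cos_squared_add3[of t] by (simp add: add.commute)
    then have "\<bar>a * d - b * c - 1\<bar> = 2 * \<bar>A * B - U * V\<bar>"
      by (simp only: abs_mult abs_numeral)
    also have "A * B - U * V = (A - U) * (B - V) + (A - U) * V + U * (B - V)"
      by (simp add: algebra_simps)
    also have "\<bar>\<dots>\<bar> \<le> \<eta> * \<eta> + \<eta> * C + C * \<eta>"
      using A B U V \<eta> unfolding U_def[symmetric] V_def[symmetric]
      by (intro order_trans[OF abs_triangle_ineq] add_mono) (auto simp: abs_mult intro!: mult_mono)
    also have "2 * (\<eta> * \<eta> + \<eta> * C + C * \<eta>) \<le> 4 * \<eta> * (2 * C + \<eta>)"
      using \<eta> U by (simp add: algebra_simps)
    finally show ?thesis by simp
  qed
  have "((\<lambda>\<eta>::real. 4 * \<eta> * (2 * C + \<eta>)) \<longlongrightarrow> 4 * 0 * (2 * C + 0)) (at_right 0)"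
    by (intro tendsto_intros)
  then have "\<bar>a * d - b * c - 1\<bar> \<le> 0"
    using bound by (intro tendsto_lowerbound[where F="at_right (0::real)"])
      (auto simp: eventually_at_right_less intro: eventually_mono[OF eventually_at_right_less[of 0]])
  then have "a * d - b * c = 1" by simp
  then show ?thesis
    by (subst area_form_linear[OF lin]) (simp add: area_form_def a_def b_def c_def d_def mult.commute)
qed

lemma exact_symplectic_lift:
  assumes ex: "exact_symplectic f" and F: "annulus_lift f F"
    and F': "\<And>w. (F has_derivative blinfun_apply (F' w)) (at w)" and cont: "continuous_on UNIV F'"
  shows "area_form (F' z v) (F' z w) = area_form v w"
proof -
  obtain S where S: "\<And>z. ((\<lambda>w. S (annulus_proj w)) has_derivative
      (\<lambda>v. snd (f (annulus_proj z)) * fst (annulus_deriv f (annulus_proj z) v) - snd z * fst v)) (at z)"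
    using ex unfolding exact_symplectic_def by blast
  have "snd (f (annulus_proj z)) = snd (F z)" for z
    by (metis annulus_lift_proj[OF F] annulus_proj_def snd_conv)
  then have S': "((\<lambda>w. S (annulus_proj w)) has_derivative (\<lambda>v. snd (F z) * fst (F' z v) - snd z * fst v)) (at z)" for z
    using S[of z] by (simp add: annulus_deriv_eq[OF F F'])
  then show ?thesis
    using exact_form_imp_area_form[OF F' _ S'] cont continuous_on_eq_continuous_at[OF open_UNIV] by blast
qed

section \<open>Paratingent cones\<close>

text \<open>The mean value inequality is applied to \<open>F - F' z\<close> on a small ball, where
  continuity of \<open>F'\<close> makes its derivative small. Both end points may therefore move, as
  paratingent vectors demand.\<close>

lemma C1_strict_derivative:
  fixes F :: "'a::real_normed_vector \<Rightarrow> 'b::real_normed_vector" and F' :: "'a \<Rightarrow> 'a \<Rightarrow>\<^sub>L 'b"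
  assumes F: "\<And>w. (F has_derivative blinfun_apply (F' w)) (at w)" and cont: "isCont F' z"
    and X: "X \<longlonglongrightarrow> z" and Y: "Y \<longlonglongrightarrow> z" and t: "\<And>n. t n > (0::real)"
    and u: "(\<lambda>n. (X n - Y n) /\<^sub>R t n) \<longlonglongrightarrow> u"
  shows "(\<lambda>n. (F (X n) - F (Y n)) /\<^sub>R t n) \<longlonglongrightarrow> F' z u"
proof -
  define R where "R n = (F (X n) - F (Y n) - F' z (X n - Y n)) /\<^sub>R t n" for n
  have "R \<longlonglongrightarrow> 0"
  proof (rule LIMSEQ_I)
    fix e :: real assume e: "e > 0"
    define K where "K = norm u + 1"
    have uK: "norm u < K" by (simp add: K_def)
    have K: "K > 0" using norm_ge_zero[of u] unfolding K_def by linarith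
    obtain d where d: "d > 0" "\<And>y. dist y z < d \<Longrightarrow> dist (F' y) (F' z) < e / (2 * K)"
      using cont e K unfolding continuous_at_eps_delta by (metis divide_pos_pos mult_pos_pos zero_less_numeral)
    have "\<forall>\<^sub>F n in sequentially. X n \<in> ball z d \<and> Y n \<in> ball z d \<and> norm ((X n - Y n) /\<^sub>R t n) < K"
      using order_tendstoD(2)[OF tendsto_norm[OF u] uK] tendstoD[OF X d(1)] tendstoD[OF Y d(1)]
      by eventually_elim (auto simp: dist_commute)
    then have "\<forall>\<^sub>F n in sequentially. norm (R n - 0) < e"
    proof eventually_elim
      case (elim n)
      define G where "G w = F w - F' z w" for w
      have "norm (G (X n) - G (Y n)) \<le> e / (2 * K) * norm (X n - Y n)"
      proof (rule differentiable_bound[where S = "ball z d" and f' = "\<lambda>w. blinfun_apply (F' w - F' z)"])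
        fix w assume w: "w \<in> ball z d"
        show "(G has_derivative blinfun_apply (F' w - F' z)) (at w within ball z d)"
          unfolding G_def blinfun.diff_left
          by (intro derivative_intros has_derivative_at_withinI[OF F] bounded_linear_imp_has_derivative
               blinfun.bounded_linear_right)
        show "onorm (blinfun_apply (F' w - F' z)) \<le> e / (2 * K)"
          using d(2)[of w] w by (simp add: norm_blinfun.rep_eq[symmetric] dist_norm norm_minus_commute)
      qed (use elim in auto)
      then have "inverse (t n) * norm (G (X n) - G (Y n)) \<le> inverse (t n) * (e / (2 * K) * norm (X n - Y n))"
        using t[of n] by (intro mult_left_mono) auto
      moreover have "R n = (G (X n) - G (Y n)) /\<^sub>R t n"
        by (simp add: R_def G_def blinfun.diff_right algebra_simps)
      ultimately have "norm (R n) \<le> inverse (t n) * (e / (2 * K) * norm (X n - Y n))"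
        using t[of n] by simp
      also have "\<dots> = e / (2 * K) * norm ((X n - Y n) /\<^sub>R t n)"
        using t[of n] by simp
      also have "\<dots> \<le> e / (2 * K) * K"
        using elim e K by (intro mult_left_mono) auto
      also have "\<dots> < e" using e K by (simp add: field_simps)
      finally show ?case by simp
    qed
    then show "\<exists>N. \<forall>n\<ge>N. norm (R n - 0) < e" by (simp add: eventually_sequentially)
  qed
  moreover have "(\<lambda>n. F' z ((X n - Y n) /\<^sub>R t n)) \<longlonglongrightarrow> F' z u"
    by (intro tendsto_intros u)
  ultimately have "(\<lambda>n. R n + F' z ((X n - Y n) /\<^sub>R t n)) \<longlonglongrightarrow> 0 + F' z u"
    by (rule tendsto_add)
  moreover have "R n + F' z ((X n - Y n) /\<^sub>R t n) = (F (X n) - F (Y n)) /\<^sub>R t n" for n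
    unfolding R_def blinfun.scaleR_right scaleR_add_right[symmetric] by simp
  ultimately show ?thesis by simp
qed

lemma annulus_strict_derivative:
  assumes lift: "annulus_lift f F"
    and F: "\<And>w. (F has_derivative blinfun_apply (F' w)) (at w)" and cont: "continuous_on UNIV F'"
    and X: "X \<longlonglongrightarrow> annulus_proj z" and Y: "Y \<longlonglongrightarrow> annulus_proj z" and t: "\<And>n. t n > (0::real)"
    and u: "(\<lambda>n. annulus_diff (X n) (Y n) /\<^sub>R t n) \<longlonglongrightarrow> u"
  shows "(\<lambda>n. annulus_diff (f (X n)) (f (Y n)) /\<^sub>R t n) \<longlonglongrightarrow> F' z u"
proof -
  \<comment> \<open>\<open>Y n\<close> is lifted next to \<open>z\<close>, and \<open>X n\<close>
    next to the lift of \<open>Y n\<close>, so that the lifted difference is exactly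
    \<open>annulus_diff (X n) (Y n)\<close>.\<close>
  define b where "b n = z + annulus_diff (Y n) (annulus_proj z)" for n
  define a where "a n = b n + annulus_diff (X n) (Y n)" for n
  have pb: "annulus_proj (b n) = Y n" for n
    by (simp add: b_def annulus_proj_add_diff)
  have pa: "annulus_proj (a n) = X n" for n
    using annulus_proj_add_diff[of "b n" "X n"] by (simp add: a_def pb)
  have "b \<longlonglongrightarrow> z + 0"
    unfolding b_def by (intro tendsto_add tendsto_const annulus_diff_tendsto_0[OF Y tendsto_const])
  then have b: "b \<longlonglongrightarrow> z" by simp
  have "a \<longlonglongrightarrow> z + 0"
    unfolding a_def by (intro tendsto_add b annulus_diff_tendsto_0[OF X Y])
  then have a: "a \<longlonglongrightarrow> z" by simp
  have contz: "isCont F' z" and contF: "isCont F z"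
    using cont annulus_lift_cont[OF lift, of UNIV] continuous_on_eq_continuous_at[OF open_UNIV] by blast+
  have "(\<lambda>n. (a n - b n) /\<^sub>R t n) \<longlonglongrightarrow> u"
    using u by (simp add: a_def)
  then have *: "(\<lambda>n. (F (a n) - F (b n)) /\<^sub>R t n) \<longlonglongrightarrow> F' z u"
    by (intro C1_strict_derivative[OF F contz a b t])
  have "(\<lambda>n. F (a n) - F (b n)) \<longlonglongrightarrow> F z - F z"
    by (intro tendsto_diff isCont_tendsto_compose[OF contF] a b)
  then have "(\<lambda>n. \<bar>fst (F (a n) - F (b n))\<bar>) \<longlonglongrightarrow> \<bar>fst (0::real\<times>real)\<bar>"
    by (intro tendsto_rabs tendsto_fst) simp
  then have "\<forall>\<^sub>F n in sequentially. \<bar>fst (F (a n) - F (b n))\<bar> < 1/2"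
    by (intro order_tendstoD(2)) auto
  then have "\<forall>\<^sub>F n in sequentially. (F (a n) - F (b n)) /\<^sub>R t n = annulus_diff (f (X n)) (f (Y n)) /\<^sub>R t n"
  proof eventually_elim
    case (elim n)
    \<comment> \<open>With angular difference below 1/2, the difference of the lifted images is the
      representative that \<open>annulus_diff\<close> selects.\<close>
    then have "annulus_diff (annulus_proj (F (a n))) (annulus_proj (F (b n))) = F (a n) - F (b n)"
      by (intro annulus_diff_proj) simp
    then show ?case by (simp add: annulus_lift_proj[OF lift] pa pb)
  qed
  from Lim_transform_eventually[OF * this] show ?thesis .
qed

lemma paratingent_cone_deriv:
  assumes lift: "annulus_lift f F"
    and F: "\<And>w. (F has_derivative blinfun_apply (F' w)) (at w)" and cont: "continuous_on UNIV F'"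
    and fM: "f ` M \<subseteq> M" and v: "v \<in> paratingent_cone M (annulus_proj z)"
  shows "F' z v \<in> paratingent_cone M (f (annulus_proj z))"
proof -
  obtain X Y t where *: "\<And>n. X n \<in> M" "\<And>n. Y n \<in> M"
    "X \<longlonglongrightarrow> annulus_proj z" "Y \<longlonglongrightarrow> annulus_proj z"
    "\<And>n. t n > (0::real)" "t \<longlonglongrightarrow> 0" "(\<lambda>n. annulus_diff (X n) (Y n) /\<^sub>R t n) \<longlonglongrightarrow> v"
    using v unfolding paratingent_cone_def by blast
  have f: "isCont f (annulus_proj z)"
    using annulus_lift_continuous[OF lift, of UNIV] continuous_on_eq_continuous_at[OF open_UNIV] by blast
  show ?thesis
    unfolding paratingent_cone_def
    by (intro CollectI exI[of _ "\<lambda>n. f (X n)"] exI[of _ "\<lambda>n. f (Y n)"] exI[of _ t] conjI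
        annulus_strict_derivative[OF lift F cont] isCont_tendsto_compose[OF f] * allI)
      (use fM * in auto)
qed

text \<open>Unit secants subconverge by compactness of the unit circle. The distances serve as the
  scales of the cone, being positive for distinct end points.\<close>

lemma secants_subseq_cone:
  assumes "\<And>n. X n \<in> M" "\<And>n. Y n \<in> M" "\<And>n. X n \<noteq> Y n" "X \<longlonglongrightarrow> x" "Y \<longlonglongrightarrow> x"
  obtains r v where "strict_mono r" "v \<in> paratingent_cone M x" "norm v = 1"
    "(\<lambda>n. annulus_diff (X (r n)) (Y (r n)) /\<^sub>R dist (X (r n)) (Y (r n))) \<longlonglongrightarrow> v"
proof -
  define s where "s n = annulus_diff (X n) (Y n) /\<^sub>R dist (X n) (Y n)" for n
  have "s n \<in> sphere 0 1" for n
    using assms(3)[of n] by (simp add: s_def norm_annulus_diff)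
  then obtain v r where v: "v \<in> sphere 0 1" and r: "strict_mono r" and lim: "(s \<circ> r) \<longlonglongrightarrow> v"
    using compact_sphere[of "0::real\<times>real" 1] unfolding compact_def by metis
  have XY: "(X \<circ> r) \<longlonglongrightarrow> x" "(Y \<circ> r) \<longlonglongrightarrow> x"
    using LIMSEQ_subseq_LIMSEQ[OF assms(4) r] LIMSEQ_subseq_LIMSEQ[OF assms(5) r] by auto
  have "(\<lambda>n. dist (X (r n)) (Y (r n))) \<longlonglongrightarrow> dist x x"
    using XY by (intro tendsto_dist) (auto simp: o_def)
  then have "v \<in> paratingent_cone M x"
    unfolding paratingent_cone_def using assms(1-3) XY lim
    by (intro CollectI exI[of _ "X \<circ> r"] exI[of _ "Y \<circ> r"] exI[of _ "\<lambda>n. dist (X (r n)) (Y (r n))"])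
       (auto simp: s_def o_def)
  with r v lim show ?thesis by (intro that) (auto simp: s_def o_def)
qed

text \<open>At an isolated point the cone is \<open>{0}\<close> and determines no line; a limit
  point supplies a unit vector, here from secants with one end fixed at \<open>x\<close>.\<close>

lemma islimpt_paratingent:
  assumes "x islimpt M" "x \<in> M"
  obtains v where "v \<in> paratingent_cone M x" "norm v = 1"
proof -
  obtain X where "\<And>n. X n \<in> M - {x}" "X \<longlonglongrightarrow> x"
    using assms(1) unfolding islimpt_sequential by blast
  then show ?thesis
    using secants_subseq_cone[of X M "\<lambda>_. x" x] that assms(2) by auto
qed

section \<open>Birkhoff sums over circle homeomorphisms with irrational rotation number\<close>

locale circle_lift_map =
  fixes H :: "real \<Rightarrow> real" and \<rho> :: real
  assumes H_mono: "strict_mono H" and H_add_1: "\<And>x. H (x + 1) = H x + 1"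
    and rotation: "has_rotation_number H \<rho>" and irrational: "\<rho> \<notin> \<rat>"
begin

lemma H_add_int: "H (x + of_int k) = H x + of_int k"
proof (induction k rule: int_induct[where k = 0])
  case (step1 i)
  then show ?case using H_add_1[of "x + of_int i"] by (simp add: add.assoc)
next
  case (step2 i)
  then show ?case using H_add_1[of "x + of_int (i - 1)"] by (simp add: algebra_simps)
qed simp

lemma funpow_add_int: "(H ^^ n) (x + of_int k) = (H ^^ n) x + of_int k"
  by (induction n) (simp_all add: H_add_int)

lemma funpow_strict_mono: "strict_mono (H ^^ n)"
  by (induction n) (use H_mono in \<open>auto simp: strict_mono_def\<close>)

text \<open>\<open>H\<close> carries the points \<open>c + k\<close> in order to
  \<open>H c + k\<close>, so a point and its image lie in corresponding gaps.\<close>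

lemma floor_H_diff: "\<lfloor>H x - H c\<rfloor> = \<lfloor>x - c\<rfloor>"
proof (rule floor_unique)
  have "c + of_int \<lfloor>x - c\<rfloor> \<le> x" "x < c + of_int (\<lfloor>x - c\<rfloor> + 1)" by linarith+
  then have "H (c + of_int \<lfloor>x - c\<rfloor>) \<le> H x" "H x < H (c + of_int (\<lfloor>x - c\<rfloor> + 1))"
    using H_mono by (simp_all only: strict_mono_less_eq strict_mono_less)
  then show "of_int \<lfloor>x - c\<rfloor> \<le> H x - H c" "H x - H c < of_int \<lfloor>x - c\<rfloor> + 1"
    unfolding H_add_int by linarith+
qed

text \<open>A displacement by at least \<open>p\<close> repeats because \<open>H ^^ n\<close> is
  monotone and commutes with integer translations. Hence one point already bounds the rotation
  number.\<close>

lemma funpow_mult_ge: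
  assumes "(H ^^ n) x \<ge> x + of_int p"
  shows "((H ^^ n) ^^ k) x \<ge> x + of_nat k * of_int p"
proof (induction k)
  case (Suc k)
  have "x + of_nat (Suc k) * of_int p \<le> (H ^^ n) x + of_nat k * of_int p"
    using assms by (simp add: algebra_simps)
  also have "\<dots> = (H ^^ n) (x + of_nat k * of_int p)"
    using funpow_add_int[of n x "of_nat k * p"] by simp
  also have "\<dots> \<le> (H ^^ n) (((H ^^ n) ^^ k) x)"
    using Suc funpow_strict_mono[of n] by (simp add: strict_mono_less_eq)
  finally show ?case by simp
qed simp

lemma funpow_mult_le:
  assumes "(H ^^ n) x \<le> x + of_int p"
  shows "((H ^^ n) ^^ k) x \<le> x + of_nat k * of_int p"
proof (induction k)
  case (Suc k)
  have "(H ^^ n) (((H ^^ n) ^^ k) x) \<le> (H ^^ n) (x + of_nat k * of_int p)"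
    using Suc funpow_strict_mono[of n] by (simp add: strict_mono_less_eq)
  also have "\<dots> = (H ^^ n) x + of_nat k * of_int p"
    using funpow_add_int[of n x "of_nat k * p"] by simp
  also have "\<dots> \<le> x + of_nat (Suc k) * of_int p"
    using assms by (simp add: algebra_simps)
  finally show ?case by simp
qed simp

lemma rotation_subseq:
  assumes "n > 0"
  shows "(\<lambda>k. (((H ^^ n) ^^ k) x - x) / real k) \<longlonglongrightarrow> real n * \<rho>"
proof -
  have "(\<lambda>m. ((H ^^ m) x - x) / real m) \<longlonglongrightarrow> \<rho>"
    using rotation by (simp add: has_rotation_number_def)
  from LIMSEQ_subseq_LIMSEQ[OF this, of "\<lambda>k. n * k"] assms
  have "(\<lambda>k. real n * (((H ^^ (n * k)) x - x) / real (n * k))) \<longlonglongrightarrow> real n * \<rho>"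
    by (intro tendsto_mult_left) (auto simp: o_def strict_mono_def)
  then show ?thesis using assms by (simp add: funpow_mult)
qed

lemma rotation_ge: "(H ^^ n) x \<ge> x + of_int p \<Longrightarrow> real n * \<rho> \<ge> of_int p"
proof (cases "n = 0")
  case False
  assume *: "(H ^^ n) x \<ge> x + of_int p"
  have "of_int p \<le> (((H ^^ n) ^^ k) x - x) / real k" if "k \<ge> 1" for k
    using funpow_mult_ge[OF *, of k] that by (simp add: field_simps)
  then show ?thesis
    using False by (intro LIMSEQ_le_const[OF rotation_subseq]) auto
qed simp

lemma rotation_le: "(H ^^ n) x \<le> x + of_int p \<Longrightarrow> real n * \<rho> \<le> of_int p"
proof (cases "n = 0")
  case False
  assume *: "(H ^^ n) x \<le> x + of_int p"
  have "(((H ^^ n) ^^ k) x - x) / real k \<le> of_int p" if "k \<ge> 1" for k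
    using funpow_mult_le[OF *, of k] that by (simp add: field_simps)
  then show ?thesis
    using False by (intro LIMSEQ_le_const2[OF rotation_subseq]) auto
qed simp

lemma no_periodic:
  assumes "(H ^^ n) x = x + of_int p"
  shows "n = 0"
proof (rule ccontr)
  assume "n \<noteq> 0"
  moreover have "real n * \<rho> = of_int p"
    using rotation_ge[of x p n] rotation_le[of n x p] assms by simp
  ultimately have "\<rho> = of_int p / of_nat n" by (simp add: field_simps)
  then show False using irrational by auto
qed

text \<open>With \<open>p\<close> the floor and the ceiling of the displacement, the two comparisons
  enclose \<open>real n * \<rho>\<close>. The error is uniform in \<open>n\<close> and
  \<open>x\<close>, and all later constants rest on this.\<close>

lemma funpow_near_rotation: "\<bar>(H ^^ n) x - x - real n * \<rho>\<bar> \<le> 1"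
  using rotation_ge[of x "\<lfloor>(H ^^ n) x - x\<rfloor>" n] rotation_le[of n x "\<lceil>(H ^^ n) x - x\<rceil>"]
  by linarith

text \<open>For \<open>a \<le> b \<le> a + 1\<close>,
  \<open>floor_sum a n x - floor_sum b n x\<close> counts the visits of the orbit to integer
  translates of \<open>[a, b)\<close>. Unlike the counts themselves, these sums are monotone in
  \<open>a\<close>.\<close>

definition floor_sum :: "real \<Rightarrow> nat \<Rightarrow> real \<Rightarrow> real"
  where "floor_sum a n x = (\<Sum>i<n. of_int \<lfloor>(H ^^ i) x - a\<rfloor>)"

lemma floor_sum_antimono: "a \<le> b \<Longrightarrow> floor_sum b n x \<le> floor_sum a n x"
  unfolding floor_sum_def by (intro sum_mono) (simp add: floor_mono)

lemma floor_sum_add_int: "floor_sum (a + of_int k) n x = floor_sum a n x - real n * of_int k"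
proof -
  have "\<lfloor>y - (a + of_int k)\<rfloor> = \<lfloor>y - a\<rfloor> - k" for y by linarith
  then show ?thesis by (simp add: floor_sum_def sum_subtractf)
qed

text \<open>Since \<open>\<lfloor>H\<^sup>i\<^sup>+\<^sup>1 x - H a\<rfloor> = \<lfloor>H\<^sup>i x - a\<rfloor>\<close>, passing from \<open>a\<close> to \<open>H a\<close> shifts the index and
  only the two boundary terms survive.\<close>

lemma floor_sum_H: "\<bar>floor_sum (H a) n x - floor_sum a n x + real n * \<rho>\<bar> \<le> 6"
proof (cases n)
  case (Suc k)
  have "floor_sum (H a) n x = of_int \<lfloor>x - H a\<rfloor> + (\<Sum>i<k. of_int \<lfloor>(H ^^ i) x - a\<rfloor>)"
    unfolding floor_sum_def Suc
    by (subst sum.lessThan_Suc_shift) (simp add: floor_H_diff)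
  moreover have "floor_sum a n x = (\<Sum>i<k. of_int \<lfloor>(H ^^ i) x - a\<rfloor>) + of_int \<lfloor>(H ^^ k) x - a\<rfloor>"
    by (simp add: floor_sum_def Suc)
  \<comment> \<open>The two displacements account for the boundary terms up to rounding; the bound 6
    is generous.\<close>
  moreover have "\<bar>H a - a - \<rho>\<bar> \<le> 1" "\<bar>(H ^^ k) x - x - real k * \<rho>\<bar> \<le> 1"
    using funpow_near_rotation[of 1 a] funpow_near_rotation[of k x] by simp_all
  moreover have "real n * \<rho> = real k * \<rho> + \<rho>" by (simp add: Suc algebra_simps)
  ultimately show ?thesis by linarith
qed (simp add: floor_sum_def)

text \<open>The one-step shift is iterated \<open>m\<close> times. The error grows with
  \<open>m\<close> only, so for fixed \<open>m\<close> it is negligible against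
  \<open>n\<close>.\<close>

lemma floor_sum_funpow:
  "\<bar>floor_sum ((H ^^ m) a + of_int k) n x - floor_sum a n x + real n * (real m * \<rho> + of_int k)\<bar> \<le> 6 * real m"
proof (induction m)
  case 0 then show ?case by (simp add: floor_sum_add_int)
next
  case (Suc m)
  have "real n * (real (Suc m) * \<rho> + of_int k) = real n * (real m * \<rho> + of_int k) + real n * \<rho>"
    by (simp add: algebra_simps)
  then show ?case
    using Suc floor_sum_H[of "(H ^^ m) a" n x] unfolding floor_sum_add_int
    by (simp add: abs_le_iff)
qed

lemma dense_rotation_orbit:
  assumes "a < b"
  obtains m :: nat and k :: int where "a < real m * \<rho> + of_int k" "real m * \<rho> + of_int k < b"
proof -
  obtain h m where "m > 0" "\<bar>of_int m * \<rho> - of_int h - (a + b) / 2\<bar> < (b - a) / 2"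
    using sequence_of_fractional_parts_is_dense[OF irrational, of "(b - a) / 2" "(a + b) / 2"] assms
    by (metis diff_gt_0_iff_gt half_gt_zero)
  then show ?thesis
    by (intro that[of "nat m" "- h"]) (auto simp: abs_less_iff field_simps)
qed

text \<open>\<open>Sup A\<close> is the value at \<open>a\<close> of the semiconjugacy from
  \<open>H\<close> to the rotation by \<open>\<rho>\<close> that sends \<open>b\<close> to 0,
  described as a cut in the orbit of \<open>b\<close> and its translates. Two such points that
  enclose \<open>a\<close>, with rotation values within \<open>\<epsilon>\<close> of each other,
  squeeze \<open>floor_sum a\<close> by monotonicity, and the shift formula evaluates the outer
  sums.\<close>

lemma floor_sum_compare:
  assumes "\<epsilon> > 0"
  obtains \<tau> C where "\<And>n x. \<bar>floor_sum a n x - floor_sum b n x - real n * \<tau>\<bar> \<le> \<epsilon> * real n + C"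
proof -
  define A where "A = {real m * \<rho> + of_int k | m (k::int). (H ^^ m) b + of_int k \<le> a}"
  have bdd: "y \<le> a - b + 1" if "y \<in> A" for y
    using that funpow_near_rotation[of _ b] unfolding A_def by (smt (verit) mem_Collect_eq)
  have "b + of_int \<lfloor>a - b\<rfloor> \<le> a" by linarith
  then have "real 0 * \<rho> + of_int \<lfloor>a - b\<rfloor> \<in> A"
    unfolding A_def by (intro CollectI exI[of _ 0] exI[of _ "\<lfloor>a - b\<rfloor>"]) auto
  then have ne: "A \<noteq> {}" by blast
  have bA: "bdd_above A" using bdd by (auto simp: bdd_above_def)
  have "Sup A - \<epsilon> / 2 < Sup A" using assms by simp
  then obtain y where "y \<in> A" "Sup A - \<epsilon> / 2 < y"
    using ne bA by (meson less_cSup_iff)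
  then obtain m k where 1: "(H ^^ m) b + of_int k \<le> a" "Sup A - \<epsilon> / 2 < real m * \<rho> + of_int k"
    unfolding A_def by blast
  obtain m' k' where 2: "Sup A < real m' * \<rho> + of_int k'" "real m' * \<rho> + of_int k' < Sup A + \<epsilon> / 2"
    using dense_rotation_orbit[of "Sup A" "Sup A + \<epsilon> / 2"] assms by auto
  have 3: "a \<le> (H ^^ m') b + of_int k'"
  proof (rule ccontr)
    assume "\<not> ?thesis"
    then have "real m' * \<rho> + of_int k' \<in> A"
      unfolding A_def by (intro CollectI exI[of _ m'] exI[of _ k']) simp
    with 2(1) cSup_upper[OF _ bA] show False by fastforce
  qed
  define C where "C = 6 * real m + 6 * real m'"
  have "\<bar>floor_sum a n x - floor_sum b n x - real n * (- (real m * \<rho> + of_int k))\<bar> \<le> \<epsilon> * real n + C" for n x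
  proof -
    have "real n * (real m' * \<rho> + of_int k') \<le> real n * (real m * \<rho> + of_int k + \<epsilon>)"
      using 1(2) 2(2) by (intro mult_left_mono) auto
    also have "\<dots> = real n * (real m * \<rho> + of_int k) + \<epsilon> * real n"
      by (simp add: algebra_simps)
    finally have le: "real n * (real m' * \<rho> + of_int k') \<le> real n * (real m * \<rho> + of_int k) + \<epsilon> * real n" .
    have "0 \<le> \<epsilon> * real n" using assms by simp
    then show ?thesis
      unfolding C_def minus_mult_right[symmetric]
      using le floor_sum_antimono[OF 1(1), of n x] floor_sum_antimono[OF 3, of n x]
        floor_sum_funpow[of m b k n x] floor_sum_funpow[of m' b k' n x]
      by linarith
  qed
  then show ?thesis by (rule that)
qed

end

text \<open>The constant \<open>c\<close> may depend on \<open>\<epsilon>\<close>, so no limit has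
  to be constructed before sums and uniform limits are formed; \<open>C\<close> absorbs errors that
  do not grow with \<open>n\<close>.\<close>

definition uniform_average :: "'a set \<Rightarrow> ('a \<Rightarrow> 'a) \<Rightarrow> ('a \<Rightarrow> real) \<Rightarrow> bool"
  where "uniform_average X g \<psi> \<longleftrightarrow> (\<forall>\<epsilon>>0. \<exists>c C. \<forall>n. \<forall>x\<in>X.
    \<bar>(\<Sum>i<n. \<psi> ((g ^^ i) x)) - real n * c\<bar> \<le> \<epsilon> * real n + C)"

lemma uniform_averageD:
  assumes "uniform_average X g \<psi>" "\<epsilon> > 0"
  obtains c C where "\<And>n x. x \<in> X \<Longrightarrow> \<bar>(\<Sum>i<n. \<psi> ((g ^^ i) x)) - real n * c\<bar> \<le> \<epsilon> * real n + C"
  using assms unfolding uniform_average_def by blast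

lemma uniform_average_add:
  assumes "uniform_average X g \<psi>" "uniform_average X g \<omega>"
  shows "uniform_average X g (\<lambda>x. \<psi> x + \<omega> x)"
  unfolding uniform_average_def
proof (intro allI impI)
  fix \<epsilon> :: real assume "\<epsilon> > 0"
  then have \<epsilon>: "\<epsilon> / 2 > 0" by simp
  obtain c C where 1: "\<And>n x. x \<in> X \<Longrightarrow> \<bar>(\<Sum>i<n. \<psi> ((g ^^ i) x)) - real n * c\<bar> \<le> \<epsilon> / 2 * real n + C"
    using uniform_averageD[OF assms(1) \<epsilon>] by blast
  obtain d D where 2: "\<And>n x. x \<in> X \<Longrightarrow> \<bar>(\<Sum>i<n. \<omega> ((g ^^ i) x)) - real n * d\<bar> \<le> \<epsilon> / 2 * real n + D"
    using uniform_averageD[OF assms(2) \<epsilon>] by blast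
  show "\<exists>c C. \<forall>n. \<forall>x\<in>X. \<bar>(\<Sum>i<n. \<psi> ((g ^^ i) x) + \<omega> ((g ^^ i) x)) - real n * c\<bar> \<le> \<epsilon> * real n + C"
  proof (rule exI[of _ "c + d"], rule exI[of _ "C + D"], intro allI ballI)
    fix n x assume "x \<in> X"
    from 1[OF this, of n] 2[OF this, of n]
    show "\<bar>(\<Sum>i<n. \<psi> ((g ^^ i) x) + \<omega> ((g ^^ i) x)) - real n * (c + d)\<bar> \<le> \<epsilon> * real n + (C + D)"
      unfolding sum.distrib distrib_left abs_le_iff by linarith
  qed
qed

lemma uniform_average_cmult:
  assumes "uniform_average X g \<psi>"
  shows "uniform_average X g (\<lambda>x. a * \<psi> x)"
  unfolding uniform_average_def
proof (intro allI impI)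
  fix \<epsilon> :: real assume \<epsilon>: "\<epsilon> > 0"
  \<comment> \<open>Adding 1 covers \<open>a = 0\<close>.\<close>
  have "\<epsilon> / (\<bar>a\<bar> + 1) > 0" using \<epsilon> by (intro divide_pos_pos) auto
  then obtain c C where 1: "\<And>n x. x \<in> X \<Longrightarrow>
      \<bar>(\<Sum>i<n. \<psi> ((g ^^ i) x)) - real n * c\<bar> \<le> \<epsilon> / (\<bar>a\<bar> + 1) * real n + C"
    using uniform_averageD[OF assms] by blast
  show "\<exists>c C. \<forall>n. \<forall>x\<in>X. \<bar>(\<Sum>i<n. a * \<psi> ((g ^^ i) x)) - real n * c\<bar> \<le> \<epsilon> * real n + C"
  proof (rule exI[of _ "a * c"], rule exI[of _ "\<bar>a\<bar> * C"], intro allI ballI)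
    fix n x assume "x \<in> X"
    have "(\<Sum>i<n. a * \<psi> ((g ^^ i) x)) - real n * (a * c) = a * ((\<Sum>i<n. \<psi> ((g ^^ i) x)) - real n * c)"
      by (simp add: sum_distrib_left algebra_simps)
    also have "\<bar>\<dots>\<bar> \<le> \<bar>a\<bar> * (\<epsilon> / (\<bar>a\<bar> + 1) * real n + C)"
      unfolding abs_mult by (intro mult_left_mono 1 \<open>x \<in> X\<close>) simp
    also have "\<dots> = \<bar>a\<bar> / (\<bar>a\<bar> + 1) * (\<epsilon> * real n) + \<bar>a\<bar> * C"
      by (simp add: algebra_simps)
    also have "\<dots> \<le> 1 * (\<epsilon> * real n) + \<bar>a\<bar> * C"
      using \<epsilon> by (intro add_right_mono mult_right_mono) (auto simp: divide_le_eq_1)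
    finally show "\<bar>(\<Sum>i<n. a * \<psi> ((g ^^ i) x)) - real n * (a * c)\<bar> \<le> \<epsilon> * real n + \<bar>a\<bar> * C" by simp
  qed
qed

lemma uniform_average_sum:
  assumes "\<And>j. j \<in> J \<Longrightarrow> uniform_average X g (\<psi> j)"
  shows "uniform_average X g (\<lambda>x. \<Sum>j\<in>J. \<psi> j x)"
proof -
  have "uniform_average X g (\<lambda>_. 0)"
    unfolding uniform_average_def by (auto intro!: exI[of _ 0])
  then show ?thesis using assms
    by (induction J rule: infinite_finite_induct) (auto intro!: uniform_average_add)
qed

lemma uniform_average_uniform_limit:
  assumes gX: "g ` X \<subseteq> X"
    and "\<And>\<epsilon>. \<epsilon> > 0 \<Longrightarrow> \<exists>\<omega>. uniform_average X g \<omega> \<and> (\<forall>x\<in>X. \<bar>\<psi> x - \<omega> x\<bar> \<le> \<epsilon>)"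
  shows "uniform_average X g \<psi>"
  unfolding uniform_average_def
proof (intro allI impI)
  fix \<epsilon> :: real assume "\<epsilon> > 0"
  then have \<epsilon>: "\<epsilon> / 2 > 0" by simp
  obtain \<omega> where \<omega>: "uniform_average X g \<omega>" "\<And>x. x \<in> X \<Longrightarrow> \<bar>\<psi> x - \<omega> x\<bar> \<le> \<epsilon> / 2"
    using assms(2)[OF \<epsilon>] by blast
  obtain c C where 1: "\<And>n x. x \<in> X \<Longrightarrow> \<bar>(\<Sum>i<n. \<omega> ((g ^^ i) x)) - real n * c\<bar> \<le> \<epsilon> / 2 * real n + C"
    using uniform_averageD[OF \<omega>(1) \<epsilon>] by blast
  show "\<exists>c C. \<forall>n. \<forall>x\<in>X. \<bar>(\<Sum>i<n. \<psi> ((g ^^ i) x)) - real n * c\<bar> \<le> \<epsilon> * real n + C"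
  proof (rule exI[of _ c], rule exI[of _ C], intro allI ballI)
    fix n x assume x: "x \<in> X"
    have orb: "(g ^^ i) x \<in> X" for i by (induction i) (use x gX in auto)
    have "\<bar>(\<Sum>i<n. \<psi> ((g ^^ i) x)) - (\<Sum>i<n. \<omega> ((g ^^ i) x))\<bar> \<le> (\<Sum>i<n. \<epsilon> / 2)"
      unfolding sum_subtractf[symmetric] by (intro order_trans[OF sum_abs] sum_mono \<omega> orb)
    also have "\<dots> = \<epsilon> / 2 * real n" by simp
    finally show "\<bar>(\<Sum>i<n. \<psi> ((g ^^ i) x)) - real n * c\<bar> \<le> \<epsilon> * real n + C"
      using 1[OF x, of n] unfolding abs_le_iff by (simp add: field_simps)
  qed
qed

context circle_lift_map
begin

text \<open>For \<open>a \<le> b \<le> a + 1\<close> the function is the indicator of the integer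
  translates of \<open>[a, b)\<close>.\<close>

lemma uniform_average_arc:
  "uniform_average X H (\<lambda>x. of_int \<lfloor>x - a\<rfloor> - of_int \<lfloor>x - b\<rfloor>)"
  unfolding uniform_average_def
proof (intro allI impI)
  fix \<epsilon> :: real assume \<epsilon>: "\<epsilon> > 0"
  obtain \<tau> C where "\<And>n x. \<bar>floor_sum a n x - floor_sum b n x - real n * \<tau>\<bar> \<le> \<epsilon> * real n + C"
    using floor_sum_compare[OF \<epsilon>, of a b] by blast
  then show "\<exists>c C. \<forall>n. \<forall>x\<in>X. \<bar>(\<Sum>i<n. of_int \<lfloor>(H ^^ i) x - a\<rfloor> - of_int \<lfloor>(H ^^ i) x - b\<rfloor>)
      - real n * c\<bar> \<le> \<epsilon> * real n + C"
    by - (rule exI[of _ \<tau>], rule exI[of _ C], simp add: floor_sum_def sum_subtractf)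
qed

text \<open>\<open>\<psi>\<close> is approximated on \<open>X\<close> by functions constant on arcs
  of length \<open>1 / N\<close>. The hypotheses are relative to \<open>X\<close>, which may lie
  over a Cantor set of the circle.\<close>

lemma uniform_average_continuous:
  assumes HX: "H ` X \<subseteq> X" and per: "\<And>x k::int. x \<in> X \<Longrightarrow> x + of_int k \<in> X \<and> \<psi> (x + of_int k) = \<psi> x"
    and unif: "uniformly_continuous_on X \<psi>"
  shows "uniform_average X H \<psi>"
proof (rule uniform_average_uniform_limit[OF HX])
  fix \<epsilon> :: real assume "\<epsilon> > 0"
  then obtain \<delta> where \<delta>: "\<delta> > 0" "\<And>x y. x \<in> X \<Longrightarrow> y \<in> X \<Longrightarrow> dist y x < \<delta> \<Longrightarrow> dist (\<psi> y) (\<psi> x) < \<epsilon>"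
    using unif unfolding uniformly_continuous_on_def by metis
  obtain N :: nat where N: "N > 0" "1 / real N < \<delta>"
    using \<delta>(1) by (metis gr_zeroI inverse_eq_divide real_arch_inverse)
  define arc where "arc j = {real j / real N ..< (real j + 1) / real N}" for j :: nat
  \<comment> \<open>If \<open>arc j\<close> misses \<open>X\<close> this value is arbitrary, but
    then the \<open>j\<close>-th summand of \<open>\<omega>\<close> vanishes on \<open>X\<close> by
    periodicity.\<close>
  define \<phi> where "\<phi> j = \<psi> (SOME y. y \<in> X \<inter> arc j)" for j
  define \<omega> where "\<omega> x = (\<Sum>j<N. \<phi> j * (of_int \<lfloor>x - real j / real N\<rfloor> - of_int \<lfloor>x - (real j + 1) / real N\<rfloor>))" for x
  have "uniform_average X H \<omega>"
    unfolding \<omega>_def by (intro uniform_average_sum uniform_average_cmult uniform_average_arc)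
  moreover have "\<bar>\<psi> x - \<omega> x\<bar> \<le> \<epsilon>" if x: "x \<in> X" for x
  proof -
    define y where "y = x + of_int (- \<lfloor>x\<rfloor>)"
    have y: "y \<in> X" "\<psi> y = \<psi> x" using per[OF x] unfolding y_def by blast+
    have y01: "0 \<le> y" "y < 1" unfolding y_def by linarith+
    define j where "j = nat \<lfloor>y * real N\<rfloor>"
    have jr: "real j = of_int \<lfloor>y * real N\<rfloor>"
      using y01 by (simp add: j_def)
    have "y * real N < real N" using y01 N(1) by simp
    then have jN: "j < N" using jr by linarith
    have yj: "y \<in> arc j"
      using N(1) unfolding arc_def atLeastLessThan_iff
      by (auto simp: field_simps jr) linarith+
    \<comment> \<open>The \<open>N\<close> arcs tile \<open>[0, 1)\<close>, so only the indicator of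
      the arc containing the reduced point \<open>y\<close> is nonzero.\<close>
    have ind: "(of_int \<lfloor>x - real i / real N\<rfloor> - of_int \<lfloor>x - (real i + 1) / real N\<rfloor> :: real) = (if i = j then 1 else 0)"
      if i: "i < N" for i
    proof -
      have x: "x = y + of_int \<lfloor>x\<rfloor>" by (simp add: y_def)
      have "\<lfloor>x - a\<rfloor> = \<lfloor>y - a\<rfloor> + \<lfloor>x\<rfloor>" for a by (subst (1) x) linarith
      then have eq: "(of_int \<lfloor>x - real i / real N\<rfloor> - of_int \<lfloor>x - (real i + 1) / real N\<rfloor> :: real)
          = of_int (\<lfloor>y - real i / real N\<rfloor> - \<lfloor>y - (real i + 1) / real N\<rfloor>)" by simp
      have b: "0 \<le> real i / real N" "(real i + 1) / real N \<le> 1"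
        using i N(1) by (simp_all add: field_simps)
      consider "i = j" | "i < j" | "i > j" by linarith
      then show ?thesis
      proof cases
        case 1
        have "\<lfloor>y - real i / real N\<rfloor> = 0" "\<lfloor>y - (real i + 1) / real N\<rfloor> = -1"
          using yj y01 b unfolding arc_def atLeastLessThan_iff 1 by linarith+
        then show ?thesis using eq 1 by simp
      next
        case 2
        then have "(real i + 1) / real N \<le> real j / real N" "real i / real N \<le> (real i + 1) / real N"
          by (auto intro!: divide_right_mono)
        then have "\<lfloor>y - real i / real N\<rfloor> = 0" "\<lfloor>y - (real i + 1) / real N\<rfloor> = 0"
          using yj y01 b unfolding arc_def atLeastLessThan_iff by linarith+
        then show ?thesis using eq 2 by simp
      next
        case 3
        then have "(real j + 1) / real N \<le> real i / real N" "real i / real N \<le> (real i + 1) / real N"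
          by (auto intro!: divide_right_mono)
        then have "\<lfloor>y - real i / real N\<rfloor> = -1" "\<lfloor>y - (real i + 1) / real N\<rfloor> = -1"
          using yj y01 b unfolding arc_def atLeastLessThan_iff by linarith+
        then show ?thesis using eq 3 by simp
      qed
    qed
    have "\<omega> x = (\<Sum>i<N. if i = j then \<phi> i else 0)"
      unfolding \<omega>_def by (intro sum.cong refl) (simp add: ind)
    also have "\<dots> = \<phi> j" using jN by simp
    finally have \<omega>x: "\<omega> x = \<phi> j" .
    define w where "w = (SOME y. y \<in> X \<inter> arc j)"
    have w: "w \<in> X \<inter> arc j"
      unfolding w_def using y yj by (intro someI[of "\<lambda>y. y \<in> X \<inter> arc j" y]) simp
    have "\<bar>y - w\<bar> < (real j + 1) / real N - real j / real N"
      using w yj unfolding arc_def by auto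
    also have "\<dots> = 1 / real N" by (simp add: diff_divide_distrib[symmetric])
    finally have "dist y w < \<delta>" using N(2) by (simp add: dist_real_def)
    then have "dist (\<psi> y) (\<psi> w) < \<epsilon>" using w y by (intro \<delta>) auto
    then show ?thesis using \<omega>x y by (simp add: \<phi>_def w_def dist_real_def)
  qed
  ultimately show "\<exists>\<omega>. uniform_average X H \<omega> \<and> (\<forall>x\<in>X. \<bar>\<psi> x - \<omega> x\<bar> \<le> \<epsilon>)" by blast
qed

end

section \<open>Vanishing average stretch on infinite compact sets\<close>

text \<open>If \<open>g\<close> shrank small distances, the images under \<open>g\<^sup>n\<close> of a fixed finite cover would be a cover
  by sets of arbitrarily small diameter, with a bounded number of members.\<close>

lemma contraction_imp_finite:
  fixes g :: "'a::metric_space \<Rightarrow> 'a"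
  assumes M: "compact M" and gM: "g ` M = M" and \<delta>: "\<delta> > 0" and \<epsilon>: "\<epsilon> > 0"
    and contr: "\<And>x y. x \<in> M \<Longrightarrow> y \<in> M \<Longrightarrow> dist x y < \<delta> \<Longrightarrow> dist (g x) (g y) \<le> exp (\<phi> x + \<epsilon>) * dist x y"
    and decay: "\<And>n x. x \<in> M \<Longrightarrow> (\<Sum>i<n. \<phi> ((g ^^ i) x)) \<le> C - 2 * \<epsilon> * real n"
  shows "finite M"
proof (rule ccontr)
  assume inf: "infinite M"
  \<comment> \<open>\<open>exp C\<close> bounds how much distances can grow before the decay sets
    in: starting below \<open>r\<close>, all iterates stay within \<open>\<delta>\<close>, where
    \<open>contr\<close> applies.\<close>
  define r where "r = \<delta> * exp (- C)"
  have r: "r > 0" using \<delta> by (simp add: r_def)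
  have iter: "(g ^^ n) x \<in> M" if "x \<in> M" for n x
    by (induction n) (use gM that in auto)
  have shrink: "dist ((g ^^ n) x) ((g ^^ n) y) \<le> exp ((\<Sum>i<n. \<phi> ((g ^^ i) x)) + real n * \<epsilon>) * dist x y
     \<and> dist ((g ^^ n) x) ((g ^^ n) y) < \<delta> * exp (- \<epsilon> * real n)"
    if xy: "x \<in> M" "y \<in> M" "dist x y < r" for x y n
  proof -
    have *: "exp ((\<Sum>i<n. \<phi> ((g ^^ i) x)) + real n * \<epsilon>) * dist x y < \<delta> * exp (- \<epsilon> * real n)" for n
    proof -
      have "exp ((\<Sum>i<n. \<phi> ((g ^^ i) x)) + real n * \<epsilon>) * dist x y \<le> exp (C - \<epsilon> * real n) * dist x y"
        using decay[OF xy(1), of n] by (intro mult_right_mono) (auto simp: algebra_simps)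
      also have "\<dots> < exp (C - \<epsilon> * real n) * r" using xy(3) by simp
      also have "\<dots> = \<delta> * (exp (C - \<epsilon> * real n) * exp (- C))"
        by (simp add: r_def)
      also have "exp (C - \<epsilon> * real n) * exp (- C) = exp (- \<epsilon> * real n)"
        by (simp add: exp_add[symmetric])
      finally show ?thesis .
    qed
    have "dist ((g ^^ n) x) ((g ^^ n) y) \<le> exp ((\<Sum>i<n. \<phi> ((g ^^ i) x)) + real n * \<epsilon>) * dist x y"
    proof (induction n)
      case (Suc n)
      have "\<delta> * exp (- \<epsilon> * real n) \<le> \<delta>" using \<delta> \<epsilon> by simp
      then have "dist ((g ^^ n) x) ((g ^^ n) y) < \<delta>"
        using Suc *[of n] by linarith
      then have "dist (g ((g ^^ n) x)) (g ((g ^^ n) y))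
          \<le> exp (\<phi> ((g ^^ n) x) + \<epsilon>) * dist ((g ^^ n) x) ((g ^^ n) y)"
        by (intro contr iter xy)
      also have "\<dots> \<le> exp (\<phi> ((g ^^ n) x) + \<epsilon>) * (exp ((\<Sum>i<n. \<phi> ((g ^^ i) x)) + real n * \<epsilon>) * dist x y)"
        by (intro mult_left_mono Suc) simp
      also have "\<dots> = exp ((\<Sum>i<Suc n. \<phi> ((g ^^ i) x)) + real (Suc n) * \<epsilon>) * dist x y"
        by (simp add: mult.assoc[symmetric] exp_add[symmetric] algebra_simps)
      finally show ?case by simp
    qed simp
    with *[of n] show ?thesis by linarith
  qed
  obtain K where K: "finite K" "M \<subseteq> (\<Union>k\<in>K. ball k (r / 2))"
    using M r unfolding compact_eq_totally_bounded by (metis half_gt_zero)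
  \<comment> \<open>One point more than there are balls: two of them have preimages under
    \<open>g ^^ n\<close> in the same ball, so they would be closer than the separation
    \<open>\<eta>\<close> of \<open>P\<close> once \<open>n\<close> is large.\<close>
  obtain P where P: "P \<subseteq> M" "finite P" "card P = Suc (card K)"
    using infinite_arbitrarily_large[OF inf] by blast
  define \<eta> where "\<eta> = Min (insert 1 ((\<lambda>(p, q). dist p q) ` {(p, q) \<in> P \<times> P. p \<noteq> q}))"
  have fin: "finite {(p, q) \<in> P \<times> P. p \<noteq> q}" using P(2) by (auto intro: finite_subset[of _ "P \<times> P"])
  have \<eta>: "\<eta> > 0" unfolding \<eta>_def using fin by (subst Min_gr_iff) auto
  have \<eta>_le: "\<eta> \<le> dist p q" if "p \<in> P" "q \<in> P" "p \<noteq> q" for p q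
    unfolding \<eta>_def using fin that by (intro Min_le) force+
  have "(\<lambda>n. \<delta> * exp (- \<epsilon> * real n)) \<longlonglongrightarrow> \<delta> * 0"
    using \<epsilon> by (intro tendsto_mult_left) real_asymp
  then have "\<forall>\<^sub>F n in sequentially. \<delta> * exp (- \<epsilon> * real n) < \<eta>"
    using \<eta> by (intro order_tendstoD(2)) auto
  then obtain n where n: "\<delta> * exp (- \<epsilon> * real n) < \<eta>" by (auto simp: eventually_sequentially)
  have gn: "(g ^^ n) ` M = M"
  proof (induction n)
    case (Suc n)
    have "(g ^^ Suc n) ` M = g ` (g ^^ n) ` M" by (simp add: image_comp o_def)
    then show ?case unfolding Suc gM .
  qed simp
  have "\<exists>s k. s \<in> M \<and> (g ^^ n) s = p \<and> k \<in> K \<and> s \<in> ball k (r / 2)" if "p \<in> P" for p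
  proof -
    have "p \<in> (g ^^ n) ` M" unfolding gn using that P(1) by blast
    then obtain s where s: "s \<in> M" "(g ^^ n) s = p" by blast
    then obtain k where "k \<in> K" "s \<in> ball k (r / 2)" using K(2) by blast
    with s show ?thesis by blast
  qed
  then obtain s k where sk: "\<And>p. p \<in> P \<Longrightarrow> s p \<in> M \<and> (g ^^ n) (s p) = p \<and> k p \<in> K \<and> s p \<in> ball (k p) (r / 2)"
    by metis
  have "card (k ` P) \<le> card K" using sk K(1) by (intro card_mono image_subsetI) blast+
  then have "\<not> inj_on k P" using P(3) card_image[of k P] by auto
  then obtain p q where pq: "p \<in> P" "q \<in> P" "p \<noteq> q" "k p = k q" by (auto simp: inj_on_def)
  have "dist (s p) (s q) < r"
  proof (rule dist_triangle_half_r)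
    show "dist (k p) (s p) < r / 2" using sk[OF pq(1)] by simp
    show "dist (k p) (s q) < r / 2" using sk[OF pq(2)] pq(4) by simp
  qed
  then have "dist ((g ^^ n) (s p)) ((g ^^ n) (s q)) < \<eta>"
    using shrink[of "s p" "s q" n] sk[OF pq(1)] sk[OF pq(2)] n by linarith
  then show False using sk[OF pq(1)] sk[OF pq(2)] \<eta>_le[OF pq(1-3)] by simp
qed

text \<open>A mean \<open>c < - 3 * e\<close> makes \<open>f\<close> contract on \<open>M\<close>,
  and \<open>c > 3 * e\<close> makes its inverse on \<open>M\<close> contract. Either would make
  \<open>M\<close> finite.\<close>

lemma local_stretch_average_zero:
  fixes f :: "'a::metric_space \<Rightarrow> 'a"
  assumes M: "compact M" "infinite M" and fM: "f ` M = M" "inj_on f M" "continuous_on M f"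
    and stretch: "\<And>\<epsilon>. \<epsilon> > 0 \<Longrightarrow> \<exists>\<delta>>0. \<forall>x\<in>M. \<forall>y\<in>M. dist x y < \<delta> \<longrightarrow>
      exp (\<phi> x - \<epsilon>) * dist x y \<le> dist (f x) (f y) \<and> dist (f x) (f y) \<le> exp (\<phi> x + \<epsilon>) * dist x y"
    and avg: "uniform_average M f \<phi>" and "\<epsilon> > 0"
  obtains C where "\<And>n x. x \<in> M \<Longrightarrow> \<bar>\<Sum>i<n. \<phi> ((f ^^ i) x)\<bar> \<le> \<epsilon> * real n + C"
proof -
  \<comment> \<open>Three quarters of \<open>\<epsilon>\<close> are spent on \<open>c\<close> and
    one on the deviation of the sums from \<open>real n * c\<close>. After that deviation a margin
    of \<open>3 * e\<close> leaves the decay rate \<open>2 * e\<close> used in the contraction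
    argument.\<close>
  define e where "e = \<epsilon> / 4"
  have e: "e > 0" using \<open>\<epsilon> > 0\<close> by (simp add: e_def)
  obtain c C where c: "\<And>n x. x \<in> M \<Longrightarrow> \<bar>(\<Sum>i<n. \<phi> ((f ^^ i) x)) - real n * c\<bar> \<le> e * real n + C"
    using uniform_averageD[OF avg e] by blast
  obtain \<delta> where \<delta>: "\<delta> > 0" "\<And>x y. x \<in> M \<Longrightarrow> y \<in> M \<Longrightarrow> dist x y < \<delta> \<Longrightarrow>
      exp (\<phi> x - e) * dist x y \<le> dist (f x) (f y) \<and> dist (f x) (f y) \<le> exp (\<phi> x + e) * dist x y"
    using stretch[OF e] by blast
  have "\<not> c < - 3 * e"
  proof
    assume "c < - 3 * e"
    then have "real n * c \<le> real n * (- 3 * e)" for n by (intro mult_left_mono) auto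
    then have "(\<Sum>i<n. \<phi> ((f ^^ i) x)) \<le> C - 2 * e * real n" if "x \<in> M" for n x
      using c[OF that, of n] by (smt (verit) mult.commute mult_minus_left distrib_right)
    then have "finite M"
      using \<delta> by (intro contraction_imp_finite[OF M(1) fM(1) \<delta>(1) e, of \<phi> C]) auto
    with M(2) show False by simp
  qed
  moreover have "\<not> c > 3 * e"
  proof
    assume "c > 3 * e"
    then have "real n * (3 * e) \<le> real n * c" for n by (intro mult_left_mono) auto
    then have grow: "2 * e * real n - C \<le> (\<Sum>i<n. \<phi> ((f ^^ i) x))" if "x \<in> M" for n x
      using c[OF that, of n] by (smt (verit) mult.commute mult_minus_left distrib_right)
    define g where "g = the_inv_into M f"
    have gM: "g ` M = M" unfolding g_def using the_inv_into_onto[OF fM(2)] by (simp add: fM(1))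
    have fg: "f (g x) = x" "g x \<in> M" if "x \<in> M" for x
    proof -
      have "x \<in> f ` M" using that fM(1) by blast
      then show "f (g x) = x" unfolding g_def by (rule f_the_inv_into_f[OF fM(2)])
      show "g x \<in> M" using that gM by blast
    qed
    have fgn: "(f ^^ n) ((g ^^ n) x) = x \<and> (g ^^ n) x \<in> M" if "x \<in> M" for n x
    proof (induction n)
      case (Suc n)
      have "(f ^^ Suc n) ((g ^^ Suc n) x) = (f ^^ n) (f (g ((g ^^ n) x)))" by (simp add: funpow_swap1)
      then show ?case using Suc fg by simp
    qed (use that in simp)
    \<comment> \<open>The backward orbit of \<open>x\<close> is the forward orbit of
      \<open>(g ^^ n) x\<close> read in reverse, so growth of the sums for \<open>f\<close> becomes
      decay for \<open>g\<close>.\<close>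
    have sum_inv: "(\<Sum>i<n. \<phi> (g ((g ^^ i) x))) = (\<Sum>i<n. \<phi> ((f ^^ i) ((g ^^ n) x)))" if "x \<in> M" for n x
      using that
    proof (induction n arbitrary: x)
      case (Suc n)
      have "(\<Sum>i<Suc n. \<phi> (g ((g ^^ i) x))) = \<phi> (g x) + (\<Sum>i<n. \<phi> (g ((g ^^ i) (g x))))"
        by (subst sum.lessThan_Suc_shift) (simp add: funpow_swap1)
      also have "\<dots> = \<phi> (g x) + (\<Sum>i<n. \<phi> ((f ^^ i) ((g ^^ n) (g x))))"
        using Suc fg by simp
      also have "\<phi> (g x) = \<phi> ((f ^^ n) ((g ^^ n) (g x)))" using fgn fg Suc.prems by simp
      finally show ?case by (simp add: funpow_swap1)
    qed simp
    have "continuous_on M g"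
      unfolding g_def using continuous_on_inv_into[OF fM(3) M(1) fM(2)] by (simp add: fM(1))
    \<comment> \<open>The lower stretch bound holds for preimages closer than
      \<open>\<delta>\<close>; uniform continuity of \<open>g\<close> provides this from closeness
      of the images.\<close>
    then have "uniformly_continuous_on M g" by (rule compact_uniformly_continuous[OF _ M(1)])
    then obtain \<delta>' where \<delta>': "\<delta>' > 0" "\<And>x y. x \<in> M \<Longrightarrow> y \<in> M \<Longrightarrow> dist x y < \<delta>' \<Longrightarrow> dist (g x) (g y) < \<delta>"
      using \<delta>(1) unfolding uniformly_continuous_on_def by metis
    have "finite M"
    proof (rule contraction_imp_finite[OF M(1) gM \<delta>'(1) e, of "\<lambda>x. - \<phi> (g x)" C])
      fix x y assume xy: "x \<in> M" "y \<in> M" "dist x y < \<delta>'"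
      have "exp (\<phi> (g x) - e) * dist (g x) (g y) \<le> dist x y"
        using \<delta>(2)[OF fg(2)[OF xy(1)] fg(2)[OF xy(2)] \<delta>'(2)[OF xy]] fg xy by simp
      then have "exp (- \<phi> (g x) + e) * (exp (\<phi> (g x) - e) * dist (g x) (g y)) \<le> exp (- \<phi> (g x) + e) * dist x y"
        by (intro mult_left_mono) auto
      then show "dist (g x) (g y) \<le> exp (- \<phi> (g x) + e) * dist x y"
        by (simp add: mult.assoc[symmetric] exp_add[symmetric])
    next
      fix n x assume "x \<in> M"
      then show "(\<Sum>i<n. - \<phi> (g ((g ^^ i) x))) \<le> C - 2 * e * real n"
        using grow[of "(g ^^ n) x" n] fgn[of x n] sum_inv[of x n] by (simp add: sum_negf)
    qed
    with M(2) show False by simp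
  qed
  ultimately have "\<bar>c\<bar> \<le> 3 * e" by linarith
  then have *: "\<bar>real n * c\<bar> \<le> 3 * e * real n" for n
    by (simp add: abs_mult mult.commute[of _ "real n"] mult_left_mono)
  show ?thesis
  proof (rule that)
    fix n x assume "x \<in> M"
    moreover have "\<epsilon> * real n = 4 * (e * real n)" "3 * e * real n = 3 * (e * real n)"
      by (simp_all add: e_def)
    ultimately show "\<bar>\<Sum>i<n. \<phi> ((f ^^ i) x)\<bar> \<le> \<epsilon> * real n + C"
      using c[of x n] *[of n] by linarith
  qed
qed

section \<open>Exponents of area-preserving cocycles with an invariant line field\<close>

lemma ln_subexponential_tendsto_0:
  assumes "\<And>\<epsilon>. \<epsilon> > 0 \<Longrightarrow> \<exists>K. \<forall>n. \<bar>a n\<bar> \<le> \<epsilon> * real n + K"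
  shows "(\<lambda>n. a n / real n) \<longlonglongrightarrow> 0"
proof (rule LIMSEQ_I)
  fix e :: real assume e: "e > 0"
  then obtain K where K: "\<And>n. \<bar>a n\<bar> \<le> e / 2 * real n + K" using assms[of "e / 2"] by auto
  obtain N where N: "2 * \<bar>K\<bar> / e < real N" using reals_Archimedean2 by blast
  have "norm (a n / real n - 0) < e" if n: "n \<ge> Suc N" for n
  proof -
    have "2 * \<bar>K\<bar> / e < real n" using N n by linarith
    then have "\<bar>K\<bar> < e / 2 * real n" using e by (simp add: field_simps)
    then have "\<bar>a n\<bar> < e * real n" using K[of n] by (simp add: field_simps)
    then show ?thesis using n by (simp add: field_simps)
  qed
  then show "\<exists>N. \<forall>n\<ge>N. norm (a n / real n - 0) < e" by blast
qed

text \<open>Coordinates in the orthonormal frame of \<open>u\<close> and its quarter turn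
  \<open>(- snd u, fst u)\<close>: the second coordinate is the area spanned with
  \<open>u\<close>.\<close>

lemma norm_sq_inner_area_form:
  assumes "norm u = 1"
  shows "(norm v)\<^sup>2 = (u \<bullet> v)\<^sup>2 + (area_form u v)\<^sup>2"
    and "v = (u \<bullet> v) *\<^sub>R u + area_form u v *\<^sub>R (- snd u, fst u)"
proof -
  have u: "(fst u)\<^sup>2 + (snd u)\<^sup>2 = 1" using assms by (simp add: norm_prod_def)
  have "(norm v)\<^sup>2 = (fst v)\<^sup>2 + (snd v)\<^sup>2" by (simp add: norm_prod_def)
  also have "\<dots> = ((fst u)\<^sup>2 + (snd u)\<^sup>2) * ((fst v)\<^sup>2 + (snd v)\<^sup>2)" by (simp add: u)
  also have "\<dots> = (u \<bullet> v)\<^sup>2 + (area_form u v)\<^sup>2"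
    by (simp add: inner_prod_def area_form_def power2_eq_square algebra_simps)
  finally show "(norm v)\<^sup>2 = (u \<bullet> v)\<^sup>2 + (area_form u v)\<^sup>2" .
  have "fst v = ((fst u)\<^sup>2 + (snd u)\<^sup>2) * fst v" "snd v = ((fst u)\<^sup>2 + (snd u)\<^sup>2) * snd v"
    by (simp_all add: u)
  then have "fst v = (u \<bullet> v) * fst u - area_form u v * snd u" "snd v = (u \<bullet> v) * snd u + area_form u v * fst u"
    by (simp_all add: inner_prod_def area_form_def power2_eq_square algebra_simps)
  then show "v = (u \<bullet> v) *\<^sub>R u + area_form u v *\<^sub>R (- snd u, fst u)"
    by (simp add: prod_eq_iff)
qed

text \<open>In the orthonormal frames starting with \<open>u n\<close> the cocycle is upper triangular with diagonal
  entries \<open>\<plusminus>exp (\<plusminus>S n)\<close>; \<open>\<alpha>\<close> and \<open>\<beta>\<close> are the coordinates of \<open>w n\<close>.\<close>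

lemma area_preserving_cocycle_exponent:
  fixes A :: "nat \<Rightarrow> real \<times> real \<Rightarrow> real \<times> real"
  assumes lin: "\<And>n. linear (A n)" and area: "\<And>n v w. area_form (A n v) (A n w) = area_form v w"
    and bound: "\<And>n v. norm (A n v) \<le> B * norm v"
    and u: "\<And>n. norm (u n) = 1" and Au: "\<And>n. A n (u n) = c n *\<^sub>R u (Suc n)" and c: "\<And>n. c n \<noteq> 0"
    and growth: "\<And>\<epsilon>. \<epsilon> > 0 \<Longrightarrow> \<exists>K. \<forall>n. \<bar>\<Sum>i<n. ln \<bar>c i\<bar>\<bar> \<le> \<epsilon> * real n + K"
    and w: "\<And>n. w (Suc n) = A n (w n)" and w0: "w 0 \<noteq> 0"
  shows "(\<lambda>n. ln (norm (w n)) / real n) \<longlonglongrightarrow> 0"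
proof (rule ln_subexponential_tendsto_0)
  fix \<epsilon>' :: real assume "\<epsilon>' > 0"
  \<comment> \<open>Four losses of \<open>\<epsilon> * real n\<close> occur in the exponent of the
    upper bound: one for the number of summands, two for \<open>S i\<close> and
    \<open>S (Suc i)\<close>, one for multiplying back by \<open>exp (S n)\<close>.\<close>
  define \<epsilon> where "\<epsilon> = \<epsilon>' / 4"
  have \<epsilon>: "\<epsilon> > 0" using \<open>\<epsilon>' > 0\<close> by (simp add: \<epsilon>_def)
  define S where "S n = (\<Sum>i<n. ln \<bar>c i\<bar>)" for n
  define \<alpha> \<beta> where "\<alpha> n = u n \<bullet> w n" and "\<beta> n = area_form (u n) (w n)" for n
  obtain K where K: "\<And>n. \<bar>S n\<bar> \<le> \<epsilon> * real n + K" using growth[OF \<epsilon>] unfolding S_def by blast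
  have expS: "exp (S (Suc n)) = \<bar>c n\<bar> * exp (S n)" for n
    using c[of n] by (simp add: S_def exp_add)
  have B: "B \<ge> 0" using order_trans[OF norm_ge_zero bound[of 0 "u 0"]] u[of 0] by simp
  \<comment> \<open>The area spanned by \<open>u n\<close> and \<open>w n\<close> is preserved while
    \<open>u n\<close> is stretched by \<open>c n\<close>, so the transverse coordinate changes by
    the inverse factor.\<close>
  have \<beta>: "\<bar>\<beta> n\<bar> * exp (S n) = \<bar>\<beta> 0\<bar>" for n
  proof (induction n)
    case (Suc n)
    have "c n * \<beta> (Suc n) = area_form (A n (u n)) (A n (w n))"
      by (simp add: \<beta>_def Au w area_form_def algebra_simps)
    also have "\<dots> = \<beta> n" by (simp add: area \<beta>_def)
    finally have eq: "\<bar>c n\<bar> * \<bar>\<beta> (Suc n)\<bar> = \<bar>\<beta> n\<bar>" by (simp add: abs_mult[symmetric])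
    have "\<bar>\<beta> (Suc n)\<bar> * exp (S (Suc n)) = \<bar>\<beta> n\<bar> * exp (S n)"
      unfolding expS eq[symmetric] by (simp add: mult_ac)
    then show ?case using Suc by simp
  qed (simp add: S_def)
  have \<beta>': "\<bar>\<beta> n\<bar> = \<bar>\<beta> 0\<bar> * exp (- S n)" for n
    unfolding \<beta>[of n, symmetric] by (simp add: mult.assoc exp_add[symmetric])
  define \<gamma> where "\<gamma> n = u (Suc n) \<bullet> A n (- snd (u n), fst (u n))" for n
  have \<gamma>: "\<bar>\<gamma> n\<bar> \<le> B" for n
  proof -
    have "\<bar>\<gamma> n\<bar> \<le> norm (u (Suc n)) * norm (A n (- snd (u n), fst (u n)))"
      unfolding \<gamma>_def by (rule Cauchy_Schwarz_ineq2)
    also have "\<dots> \<le> B * norm (- snd (u n), fst (u n))" using bound u by simp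
    also have "norm (- snd (u n), fst (u n)) = norm (u n)" by (simp add: norm_prod_def add.commute)
    finally show ?thesis using u by simp
  qed
  have \<alpha>_Suc: "\<alpha> (Suc n) = c n * \<alpha> n + \<beta> n * \<gamma> n" for n
  proof -
    have "w (Suc n) = A n (\<alpha> n *\<^sub>R u n + \<beta> n *\<^sub>R (- snd (u n), fst (u n)))"
      unfolding w \<alpha>_def \<beta>_def norm_sq_inner_area_form(2)[OF u[of n], of "w n", symmetric] ..
    also have "\<dots> = \<alpha> n *\<^sub>R c n *\<^sub>R u (Suc n) + \<beta> n *\<^sub>R A n (- snd (u n), fst (u n))"
      by (simp only: linear_add[OF lin] linear_scale[OF lin] Au)
    finally show ?thesis
      using u[of "Suc n"] by (simp add: \<alpha>_def \<gamma>_def inner_add_right norm_eq_1)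
  qed
  \<comment> \<open>Variation of constants: after division by the diagonal product
    \<open>exp (S n)\<close>, the recursion only accumulates the off-diagonal contributions.\<close>
  have \<alpha>: "\<bar>\<alpha> n\<bar> * exp (- S n) \<le> \<bar>\<alpha> 0\<bar> + (\<Sum>i<n. B * \<bar>\<beta> 0\<bar> * exp (- S i - S (Suc i)))" for n
  proof (induction n)
    case (Suc n)
    have e: "exp (- S (Suc n)) * \<bar>c n\<bar> = exp (- S n)"
      using c[of n] expS[of n] by (simp add: exp_minus field_simps)
    have "\<bar>\<alpha> (Suc n)\<bar> \<le> \<bar>c n\<bar> * \<bar>\<alpha> n\<bar> + \<bar>\<beta> n\<bar> * B"
      unfolding \<alpha>_Suc using \<gamma>[of n]
      by (intro order_trans[OF abs_triangle_ineq] add_mono) (auto simp: abs_mult intro!: mult_left_mono)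
    then have "\<bar>\<alpha> (Suc n)\<bar> * exp (- S (Suc n)) \<le> (\<bar>c n\<bar> * \<bar>\<alpha> n\<bar> + \<bar>\<beta> n\<bar> * B) * exp (- S (Suc n))"
      by (intro mult_right_mono) auto
    also have "\<dots> = \<bar>\<alpha> n\<bar> * (exp (- S (Suc n)) * \<bar>c n\<bar>) + B * \<bar>\<beta> n\<bar> * exp (- S (Suc n))"
      by (simp add: algebra_simps)
    also have "\<dots> = \<bar>\<alpha> n\<bar> * exp (- S n) + B * \<bar>\<beta> 0\<bar> * exp (- S n - S (Suc n))"
      unfolding e unfolding \<beta>'[of n] by (simp add: exp_diff exp_minus field_simps)
    finally show ?case using Suc by simp
  qed (simp add: S_def)
  \<comment> \<open>The division by \<open>\<epsilon>\<close> comes from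
    \<open>real n \<le> exp (\<epsilon> * real n) / \<epsilon>\<close>, which absorbs the number of
    summands.\<close>
  define Q where "Q = B * \<bar>\<beta> 0\<bar> * exp (2 * K) / \<epsilon>"
  have Q: "Q \<ge> 0" using B \<epsilon> by (simp add: Q_def)
  define D where "D = \<bar>\<alpha> 0\<bar> + Q + \<bar>\<beta> 0\<bar> + 1"
  have D: "D > 0" using Q unfolding D_def by (intro add_nonneg_pos add_nonneg_nonneg) auto
  have upper: "norm (w n) \<le> exp (4 * \<epsilon> * real n + K) * D" for n
  proof -
    have n: "real n \<le> exp (\<epsilon> * real n) / \<epsilon>"
    proof -
      have "\<epsilon> * real n \<le> exp (\<epsilon> * real n)" using exp_ge_add_one_self[of "\<epsilon> * real n"] by linarith
      then show ?thesis using \<epsilon> by (simp add: pos_le_divide_eq mult.commute)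
    qed
    have "(\<Sum>i<n. B * \<bar>\<beta> 0\<bar> * exp (- S i - S (Suc i))) \<le> (\<Sum>i<n. B * \<bar>\<beta> 0\<bar> * exp (2 * \<epsilon> * real n + 2 * K))"
    proof (intro sum_mono mult_left_mono)
      fix i assume "i \<in> {..<n}"
      then have "\<epsilon> * real i \<le> \<epsilon> * real n" "\<epsilon> * real (Suc i) \<le> \<epsilon> * real n"
        using \<epsilon> by (auto intro!: mult_left_mono)
      then show "exp (- S i - S (Suc i)) \<le> exp (2 * \<epsilon> * real n + 2 * K)"
        using K[of i] K[of "Suc i"] by simp
    qed (use B in auto)
    also have "\<dots> = real n * (B * \<bar>\<beta> 0\<bar> * exp (2 * \<epsilon> * real n + 2 * K))" by simp
    also have "\<dots> \<le> exp (\<epsilon> * real n) / \<epsilon> * (B * \<bar>\<beta> 0\<bar> * exp (2 * \<epsilon> * real n + 2 * K))"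
      using n B by (intro mult_right_mono) auto
    also have "\<dots> = Q * exp (3 * \<epsilon> * real n)"
    proof -
      have "exp (\<epsilon> * real n) * exp (2 * \<epsilon> * real n + 2 * K) = exp (2 * K) * exp (3 * \<epsilon> * real n)"
        unfolding exp_add[symmetric] by (simp add: algebra_simps)
      then show ?thesis by (simp add: Q_def field_simps)
    qed
    finally have a: "\<bar>\<alpha> n\<bar> * exp (- S n) \<le> \<bar>\<alpha> 0\<bar> + Q * exp (3 * \<epsilon> * real n)"
      using \<alpha>[of n] by linarith
    have e1: "1 \<le> exp (3 * \<epsilon> * real n)" using \<epsilon> by simp
    have "(norm (w n))\<^sup>2 \<le> (\<bar>\<alpha> n\<bar> + \<bar>\<beta> n\<bar>)\<^sup>2"
      unfolding norm_sq_inner_area_form(1)[OF u[of n], of "w n"] \<alpha>_def \<beta>_def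
      by (simp add: power2_sum)
    then have "norm (w n) \<le> \<bar>\<alpha> n\<bar> + \<bar>\<beta> n\<bar>" by (rule power2_le_imp_le) simp
    also have "\<dots> = exp (S n) * (\<bar>\<alpha> n\<bar> * exp (- S n)) + \<bar>\<beta> 0\<bar> * exp (- S n)"
      unfolding \<beta>'[of n] by (simp add: exp_minus)
    also have "\<dots> \<le> exp (\<epsilon> * real n + K) * (\<bar>\<alpha> 0\<bar> + Q * exp (3 * \<epsilon> * real n))
        + \<bar>\<beta> 0\<bar> * exp (\<epsilon> * real n + K)"
      using K[of n] a Q by (intro add_mono mult_mono) auto
    also have "\<dots> = exp (\<epsilon> * real n + K) * (\<bar>\<alpha> 0\<bar> * 1 + Q * exp (3 * \<epsilon> * real n) + \<bar>\<beta> 0\<bar> * 1)"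
      by (simp add: algebra_simps)
    also have "\<dots> \<le> exp (\<epsilon> * real n + K) * (\<bar>\<alpha> 0\<bar> * exp (3 * \<epsilon> * real n)
        + Q * exp (3 * \<epsilon> * real n) + \<bar>\<beta> 0\<bar> * exp (3 * \<epsilon> * real n))"
      using e1 Q by (intro mult_left_mono add_mono) auto
    also have "\<dots> = exp (\<epsilon> * real n + K) * exp (3 * \<epsilon> * real n) * (D - 1)"
      by (simp add: D_def algebra_simps)
    also have "exp (\<epsilon> * real n + K) * exp (3 * \<epsilon> * real n) = exp (4 * \<epsilon> * real n + K)"
      unfolding exp_add[symmetric] by (simp add: algebra_simps)
    also have "exp (4 * \<epsilon> * real n + K) * (D - 1) \<le> exp (4 * \<epsilon> * real n + K) * D" by simp
    finally show ?thesis .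
  qed
  \<comment> \<open>A vector off the line is bounded below by its transverse coordinate. If
    \<open>\<beta> 0 = 0\<close>, the vector stays on the line and has length exactly
    \<open>\<bar>\<alpha> 0\<bar> * exp (S n)\<close>.\<close>
  obtain m where m: "m > 0" "\<And>n. norm (w n) \<ge> m * exp (- \<epsilon> * real n - K)"
  proof (cases "\<beta> 0 = 0")
    case False
    have "\<bar>\<beta> 0\<bar> * exp (- \<epsilon> * real n - K) \<le> norm (w n)" for n
    proof -
      have "\<bar>\<beta> 0\<bar> * exp (- \<epsilon> * real n - K) \<le> \<bar>\<beta> 0\<bar> * exp (- S n)"
        using K[of n] by (intro mult_left_mono) auto
      also have "\<dots> = \<bar>\<beta> n\<bar>" by (rule \<beta>'[symmetric])
      also have "\<bar>\<beta> n\<bar> \<le> norm (w n)"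
      proof (rule power2_le_imp_le)
        show "\<bar>\<beta> n\<bar>\<^sup>2 \<le> (norm (w n))\<^sup>2"
          unfolding norm_sq_inner_area_form(1)[OF u[of n], of "w n"] by (simp add: \<beta>_def)
      qed simp
      finally show ?thesis .
    qed
    then show ?thesis using False by (intro that[of "\<bar>\<beta> 0\<bar>"]) auto
  next
    case True
    have z: "\<beta> n = 0" for n using \<beta>'[of n] True by simp
    have nw: "norm (w n) = \<bar>\<alpha> n\<bar>" for n
    proof -
      have "(norm (w n))\<^sup>2 = \<bar>\<alpha> n\<bar>\<^sup>2"
        using norm_sq_inner_area_form(1)[OF u[of n], of "w n"] z[of n] by (simp add: \<alpha>_def \<beta>_def)
      then show ?thesis by (rule power2_eq_imp_eq) simp_all
    qed
    have \<alpha>S: "\<bar>\<alpha> n\<bar> = \<bar>\<alpha> 0\<bar> * exp (S n)" for n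
    proof (induction n)
      case (Suc n)
      then show ?case unfolding \<alpha>_Suc z expS by (simp add: abs_mult)
    qed (simp add: S_def)
    have "\<bar>\<alpha> 0\<bar> * exp (- \<epsilon> * real n - K) \<le> norm (w n)" for n
      unfolding nw \<alpha>S[of n] using K[of n] by (intro mult_left_mono) auto
    moreover have "\<bar>\<alpha> 0\<bar> > 0" using nw[of 0] w0 by (metis zero_less_norm_iff)
    ultimately show ?thesis by (intro that[of "\<bar>\<alpha> 0\<bar>"]) auto
  qed
  have "\<bar>ln (norm (w n))\<bar> \<le> \<epsilon>' * real n + (\<bar>K\<bar> + \<bar>ln D\<bar> + \<bar>ln m\<bar>)" for n
  proof -
    have pos: "norm (w n) > 0" using m(1) m(2)[of n] by (meson exp_gt_zero less_le_trans mult_pos_pos)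
    have "ln (norm (w n)) \<le> ln (exp (4 * \<epsilon> * real n + K) * D)"
      using upper[of n] pos D by (intro ln_mono) auto
    also have "\<dots> = \<epsilon>' * real n + K + ln D" using D by (simp add: ln_mult \<epsilon>_def)
    finally have 1: "ln (norm (w n)) \<le> \<epsilon>' * real n + K + ln D" .
    have "ln (m * exp (- \<epsilon> * real n - K)) \<le> ln (norm (w n))"
      using m(2)[of n] pos m(1) by (intro ln_mono) auto
    then have 2: "ln m - \<epsilon> * real n - K \<le> ln (norm (w n))" using m(1) by (simp add: ln_mult)
    have "\<epsilon> * real n \<le> \<epsilon>' * real n" using \<open>\<epsilon>' > 0\<close> by (simp add: \<epsilon>_def)
    then show ?thesis using 1 2 by linarith
  qed
  then show "\<exists>K. \<forall>n. \<bar>ln (norm (w n))\<bar> \<le> \<epsilon>' * real n + K" by blast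
qed

section \<open>Aubry-Mather sets\<close>

lemma twist_map_C1_diffeo:
  assumes "twist_map f"
  shows "annulus_C1_diffeo f"
proof -
  have "annulus_C1_diffeo (inv g)" if "annulus_C1_diffeo g" for g
    using that by (auto simp: annulus_C1_diffeo_def bij_imp_bij_inv inv_inv_eq)
  then show ?thesis
    using assms by (auto simp: twist_map_def positive_twist_map_def negative_twist_map_def)
qed

lemma C1_diffeo_lift:
  assumes "annulus_C1_diffeo f"
  obtains F F' where "annulus_lift f F" "\<And>w. (F has_derivative blinfun_apply (F' w)) (at w)"
    "continuous_on UNIV F'"
  using assms unfolding annulus_C1_diffeo_def annulus_C1_map_def C1_map_def by blast

lemma ordered_setD:
  assumes "ordered_set f M"
  shows "M \<noteq> {}" "compact M" "f ` M = M"
  using assms[unfolded ordered_set_def]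
  by (rule conjunct1, rule conjunct2[THEN conjunct1], rule conjunct2[THEN conjunct2, THEN conjunct1])

lemma ordered_set_less_iff:
  assumes "ordered_set f M" "annulus_lift f F" "annulus_proj a \<in> M" "annulus_proj b \<in> M"
  shows "fst a < fst b \<longleftrightarrow> fst (F a) < fst (F b)"
  using assms unfolding ordered_set_def by (meson vimageI2)

lemma ordered_set_subset:
  assumes "ordered_set f M" "N \<subseteq> M" "N \<noteq> {}" "compact N" "f ` N = N"
  shows "ordered_set f N"
  unfolding ordered_set_def
proof (intro conjI allI impI ballI assms)
  fix F a b assume "annulus_lift f F" "a \<in> annulus_proj -` N" "b \<in> annulus_proj -` N"
  then show "fst a < fst b \<longleftrightarrow> fst (F a) < fst (F b)"
    using assms(2) by (intro ordered_set_less_iff[OF assms(1)]) auto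
qed

text \<open>Points of \<open>M\<close> on one vertical have images on one vertical, and conversely,
  by the order condition in both directions. The twist condition recovers the height from the angles
  of a point and of its image; for a negative twist map it is used for the inverse
  \<open>g\<close>.\<close>

lemma ordered_set_fst_inj:
  assumes twist: "twist_map f" and M: "ordered_set f M"
  shows "inj_on fst M"
proof (rule inj_onI)
  fix x y assume xy: "x \<in> M" "y \<in> M" "fst x = fst y"
  obtain t where t: "fst x = circle_of t" by (rule circle_of_surj)
  define z w where "z = (t, snd x)" and "w = (t, snd y)"
  have zw: "annulus_proj z = x" "annulus_proj w = y" "fst z = fst w"
    using t xy(3) by (auto simp: z_def w_def annulus_proj_def prod_eq_iff)
  obtain F where F: "annulus_lift f F"
    using twist_map_C1_diffeo[OF twist] unfolding annulus_C1_diffeo_def annulus_C1_map_def by blast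
  note ord = ordered_set_less_iff[OF M F]
  have ord_eq: "fst a = fst b \<longleftrightarrow> fst (F a) = fst (F b)" if "annulus_proj a \<in> M" "annulus_proj b \<in> M" for a b
    using ord[OF that] ord[OF that(2,1)] by linarith
  consider "positive_twist_map f" | g where "positive_twist_map g" "f = inv g"
    using twist unfolding twist_map_def negative_twist_map_def by blast
  then have "snd x = snd y"
  proof cases
    case 1
    then have "strict_mono (\<lambda>r. fst (F (t, r)))"
      using F unfolding positive_twist_map_def by blast
    moreover have "fst (F z) = fst (F w)"
      using ord_eq[of z w] zw xy by simp
    ultimately show ?thesis
      using strict_mono_eq[of "\<lambda>r. fst (F (t, r))" "snd x" "snd y"] by (simp add: z_def w_def)
  next
    case 2
    then obtain G where G: "annulus_lift g G"
      unfolding positive_twist_map_def annulus_C1_diffeo_def annulus_C1_map_def by blast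
    have mono: "strict_mono (\<lambda>r. fst (G (t, r)))"
      using 2(1) G unfolding positive_twist_map_def by blast
    have bij: "bij g" using 2(1) by (simp add: positive_twist_map_def annulus_C1_diffeo_def)
    have fg: "f (g a) = a" for a unfolding 2(2) by (rule inv_f_f[OF bij_is_inj[OF bij]])
    have gf: "g (f a) = a" for a unfolding 2(2) by (rule surj_f_inv_f[OF bij_is_surj[OF bij]])
    have gM: "g a \<in> M" if "a \<in> M" for a
    proof -
      have "a \<in> f ` M" using that by (simp only: ordered_setD(3)[OF M])
      then show ?thesis by (auto simp: gf)
    qed
    \<comment> \<open>\<open>F\<close> and \<open>G\<close> are chosen independently; their
      composite lifts the identity, so it is an integer translation and preserves equality of first
      coordinates.\<close>
    have FG: "annulus_lift id (\<lambda>v. F (G v))"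
      by (rule annulus_liftI[OF continuous_on_compose2[OF annulus_lift_cont[OF F, of UNIV] annulus_lift_cont[OF G]]])
        (simp_all add: annulus_lift_proj[OF F] annulus_lift_proj[OF G] fg)
    have "annulus_lift id (\<lambda>v. v)"
      by (rule annulus_liftI) (auto intro: continuous_intros)
    from annulus_lift_unique[OF this FG] obtain k :: int where "\<And>v. F (G v) = v + (of_int k, 0)"
      by blast
    then have "fst (F (G z)) = fst (F (G w))" by (simp add: zw)
    then have "fst (G z) = fst (G w)"
      using ord_eq[of "G z" "G w"] zw xy gM by (simp add: annulus_lift_proj[OF G])
    then show ?thesis
      using strict_mono_eq[OF mono, of "snd x" "snd y"] by (simp add: z_def w_def)
  qed
  with xy(3) show "x = y" by (simp add: prod_eq_iff)
qed

lemma circle_lift_unique: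
  assumes "circle_lift h H" "circle_lift h G"
  obtains k :: int where "\<And>x. G x = H x + of_int k"
proof -
  have "G x - H x \<in> \<int>" for x
    using assms unfolding circle_lift_def circle_of_eq_iff[symmetric] by simp
  moreover have "continuous_on UNIV (\<lambda>x. G x - H x)"
    using assms by (auto simp: circle_lift_def intro!: continuous_intros)
  ultimately obtain k :: int where k: "\<And>x. G x - H x = of_int k"
    using continuous_Ints_const by blast
  have "G x = H x + of_int k" for x using k[of x] by simp
  then show ?thesis by (rule that)
qed

text \<open>Every lift differs by an integer from an increasing one. The degree \<open>k\<close> is
  positive by monotonicity; if \<open>k \<ge> 2\<close>, the value \<open>H 0 + 1\<close> is taken
  strictly between 0 and 1, against injectivity of \<open>h\<close>.\<close>

lemma orientation_preserving_lift:
  assumes h: "orientation_preserving_homeo h" and H: "circle_lift h H"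
  shows "strict_mono H" "H (x + 1) = H x + 1"
proof -
  obtain G where G: "circle_lift h G" "strict_mono G"
    using h unfolding orientation_preserving_homeo_def by blast
  obtain k :: int where "\<And>x. H x = G x + of_int k" using circle_lift_unique[OF G(1) H] by blast
  with G(2) show mono: "strict_mono H" by (simp add: strict_mono_def)
  have inj: "inj h"
    using h unfolding orientation_preserving_homeo_def by (auto dest: homeomorphic_imp_injective_map)
  have cont: "continuous_on UNIV H" and lift: "\<And>x. circle_of (H x) = h (circle_of x)"
    using H by (auto simp: circle_lift_def)
  have "circle_lift h (\<lambda>x. H (x + 1))"
    unfolding circle_lift_def
  proof (intro conjI allI)
    show "continuous_on UNIV (\<lambda>x. H (x + 1))"
      by (rule continuous_on_compose2[OF cont]) (auto intro!: continuous_intros)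
    show "circle_of (H (x + 1)) = h (circle_of x)" for x
      using circle_of_add_of_int[of x 1] lift by simp
  qed
  then obtain k :: int where k: "\<And>x. H (x + 1) = H x + of_int k"
    using circle_lift_unique[OF H] by blast
  have "k = 1"
  proof (rule ccontr)
    assume "k \<noteq> 1"
    moreover have "k > 0" using strict_monoD[OF mono, of 0 1] k[of 0] by simp
    ultimately have k2: "k \<ge> 2" by linarith
    then have "H 0 \<le> H 0 + 1" "H 0 + 1 \<le> H 1" using k[of 0] by simp_all
    then obtain y where y: "0 \<le> y" "y \<le> 1" "H y = H 0 + 1"
      using IVT'[of H 0 "H 0 + 1" 1] continuous_on_subset[OF cont] by auto
    have "circle_of (H y) = circle_of (H 0)" by (simp add: y(3) circle_of_eq_iff)
    then have "circle_of y = circle_of 0" using lift inj by (metis injD)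
    then have "y \<in> \<int>" by (simp add: circle_of_eq_iff)
    then obtain i :: int where "y = of_int i" by (auto elim: Ints_cases)
    then have "y = 0 \<or> y = 1" using y(1,2) by auto
    then show False using y(3) k[of 0] k2 by auto
  qed
  then show "H (x + 1) = H x + 1" using k by simp
qed

text \<open>The limit points of \<open>M\<close> form an ordered set, so by minimality there are no others.\<close>

lemma AM_set_islimpt:
  assumes f: "annulus_C1_diffeo f" and M: "aubry_mather_set f M" and inf: "infinite M" and x: "x \<in> M"
  shows "x islimpt M"
proof -
  define N where "N = {x \<in> M. x islimpt M}"
  have ordM: "ordered_set f M" using M unfolding aubry_mather_set_def by (rule conjunct1)
  note cM = ordered_setD(2)[OF ordM] and fM = ordered_setD(3)[OF ordM]
  have bij: "bij f" using f by (simp add: annulus_C1_diffeo_def)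
  obtain F where "annulus_lift f F" using f unfolding annulus_C1_diffeo_def annulus_C1_map_def by blast
  then have cf: "continuous_on UNIV f" by (rule annulus_lift_continuous)
  obtain G where "annulus_lift (inv f) G" using f unfolding annulus_C1_diffeo_def annulus_C1_map_def by blast
  then have cg: "continuous_on UNIV (inv f)" by (rule annulus_lift_continuous)
  have inj: "inj f" "inj (inv f)" and f_inv: "\<And>y. f (inv f y) = y"
    using bij bij_imp_bij_inv[OF bij] by (auto simp: bij_def surj_f_inv_f)
  have gM: "inv f ` M = M"
    using image_inv_f_f[OF inj(1), of M] by (simp only: fM)
  \<comment> \<open>Used for \<open>f\<close> and for \<open>inv f\<close>, which gives the two
    inclusions between \<open>N\<close> and its image.\<close>
  have step: "g y islimpt M" if "continuous_on UNIV g" "inj g" "g ` M = M" "y islimpt M" for g y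
  proof -
    obtain X where X: "\<And>n. X n \<in> M - {y}" "X \<longlonglongrightarrow> y"
      using \<open>y islimpt M\<close> unfolding islimpt_sequential by blast
    have "isCont g y" using that(1) continuous_on_eq_continuous_at[OF open_UNIV] by blast
    then have "(\<lambda>n. g (X n)) \<longlonglongrightarrow> g y" using X(2) by (rule isCont_tendsto_compose)
    moreover have "g (X n) \<in> M - {g y}" for n
      using X(1)[of n] that(2,3) by (auto dest: injD)
    ultimately show ?thesis unfolding islimpt_sequential by (intro exI[of _ "\<lambda>n. g (X n)"]) auto
  qed
  have "closed N"
    unfolding closed_sequential_limits
  proof (intro allI impI)
    fix X l assume X: "(\<forall>n. X n \<in> N) \<and> X \<longlonglongrightarrow> l"
    then have "l \<in> M" using cM[THEN compact_imp_closed] unfolding closed_sequential_limits N_def by blast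
    moreover have "l \<in> {x. x islimpt M}"
      using X closed_limpts[of M] unfolding closed_sequential_limits N_def by blast
    ultimately show "l \<in> N" by (simp add: N_def)
  qed
  then have "compact N" using compact_Int_closed[OF cM, of N] by (simp add: N_def Int_absorb1 Collect_conj_eq)
  moreover have "N \<noteq> {}"
    using Heine_Borel_imp_Bolzano_Weierstrass[OF cM inf order_refl] by (auto simp: N_def)
  moreover have "f ` N = N"
  proof
    show "f ` N \<subseteq> N" using step[OF cf inj(1) fM] fM unfolding N_def by blast
    show "N \<subseteq> f ` N"
    proof
      fix y assume y: "y \<in> N"
      have "inv f y \<in> N"
        using step[OF cg inj(2) gM] y gM unfolding N_def by blast
      then show "y \<in> f ` N" using f_inv[of y] by (metis imageI)
    qed
  qed
  moreover have NM: "N \<subseteq> M" by (auto simp: N_def)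
  ultimately have "ordered_set f N" by (intro ordered_set_subset[OF ordM])
  then have "N = M" using M NM unfolding aubry_mather_set_def by blast
  then show ?thesis using x by (auto simp: N_def)
qed

section \<open>Stretch of distances along the paratingent lines\<close>

lemma paratingent_line:
  assumes "C1_regular_at M x" "u \<in> paratingent_cone M x" "norm u = 1" "v \<in> paratingent_cone M x"
  obtains c where "v = c *\<^sub>R u"
proof -
  obtain D where D: "subspace D" "dim D = 1" "paratingent_cone M x \<subseteq> D"
    using assms(1) unfolding C1_regular_at_def by blast
  have "u \<noteq> 0" using assms(3) by auto
  then have "span {u} = D"
    using D assms(2) by (intro subspace_dim_equal span_minimal) (auto simp: dim_eq_card_independent)
  then have "v \<in> span {u}" using D(3) assms(4) by auto
  then show ?thesis using that by (auto simp: span_singleton)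
qed

text \<open>A failure would give pairs that violate the bound at every index, so convergence along
  any index sequence \<open>r\<close> refutes it.\<close>

lemma LIMSEQ_pair_criterion:
  fixes g :: "'a::metric_space \<Rightarrow> 'a \<Rightarrow> real"
  assumes sub: "\<And>X Y. (\<And>n. X n \<in> M) \<Longrightarrow> (\<And>n. Y n \<in> M) \<Longrightarrow> (\<And>n. X n \<noteq> Y n) \<Longrightarrow> X \<longlonglongrightarrow> x \<Longrightarrow> Y \<longlonglongrightarrow> x
      \<Longrightarrow> \<exists>r :: nat \<Rightarrow> nat. (\<lambda>n. g (X (r n)) (Y (r n))) \<longlonglongrightarrow> l"
    and "\<epsilon> > 0"
  obtains \<delta> where "\<delta> > 0" "\<And>a b. a \<in> M \<Longrightarrow> b \<in> M \<Longrightarrow> a \<noteq> b \<Longrightarrow> dist a x < \<delta> \<Longrightarrow> dist b x < \<delta> \<Longrightarrow> \<bar>g a b - l\<bar> < \<epsilon>"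
proof (rule ccontr)
  assume "\<not> thesis"
  then have "\<exists>a b. a \<in> M \<and> b \<in> M \<and> a \<noteq> b \<and> dist a x < inverse (real (Suc n)) \<and> dist b x < inverse (real (Suc n))
      \<and> \<bar>g a b - l\<bar> \<ge> \<epsilon>" for n
    using that[of "inverse (real (Suc n))"] by (metis inverse_positive_iff_positive not_less of_nat_0_less_iff zero_less_Suc)
  then obtain X Y where XY: "\<And>n. X n \<in> M \<and> Y n \<in> M \<and> X n \<noteq> Y n \<and> dist (X n) x < inverse (real (Suc n))
      \<and> dist (Y n) x < inverse (real (Suc n)) \<and> \<bar>g (X n) (Y n) - l\<bar> \<ge> \<epsilon>"
    by metis
  have to_x: "Z \<longlonglongrightarrow> x" if "\<And>n. dist (Z n) x < inverse (real (Suc n))" for Z :: "nat \<Rightarrow> 'a"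
    by (rule metric_tendsto_imp_tendsto[OF LIMSEQ_inverse_real_of_nat])
      (use that in \<open>auto intro!: always_eventually less_imp_le simp: dist_real_def\<close>)
  obtain r :: "nat \<Rightarrow> nat" where "(\<lambda>n. g (X (r n)) (Y (r n))) \<longlonglongrightarrow> l"
    using sub[of X Y] XY to_x[of X] to_x[of Y] by blast
  then have "\<forall>\<^sub>F n in sequentially. \<bar>g (X (r n)) (Y (r n)) - l\<bar> < \<epsilon>"
    using \<open>\<epsilon> > 0\<close> by (auto dest: tendstoD simp: dist_real_def)
  then have "\<forall>\<^sub>F n :: nat in sequentially. False"
    by eventually_elim (use XY in \<open>metis not_less\<close>)
  then show False by simp
qed

text \<open>For \<open>y\<close> near \<open>x\<close> and \<open>b\<close> very close to
  \<open>y\<close>, the value \<open>g y b\<close> is near both \<open>\<phi> x\<close> and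
  \<open>\<phi> y\<close>; such a \<open>b \<noteq> y\<close> exists because \<open>y\<close> is a
  limit point. The uniform statement then follows from compactness.\<close>

lemma pair_limit_uniform:
  fixes g :: "'a::metric_space \<Rightarrow> 'a \<Rightarrow> real"
  assumes M: "compact M" "\<And>x. x \<in> M \<Longrightarrow> x islimpt M"
    and lim: "\<And>x \<epsilon>. x \<in> M \<Longrightarrow> \<epsilon> > 0 \<Longrightarrow> \<exists>\<delta>>0. \<forall>a\<in>M. \<forall>b\<in>M.
      a \<noteq> b \<longrightarrow> dist a x < \<delta> \<longrightarrow> dist b x < \<delta> \<longrightarrow> \<bar>g a b - \<phi> x\<bar> < \<epsilon>"
  shows "continuous_on M \<phi>"
    and "\<epsilon> > 0 \<Longrightarrow> \<exists>\<delta>>0. \<forall>a\<in>M. \<forall>b\<in>M. a \<noteq> b \<longrightarrow> dist a b < \<delta> \<longrightarrow> \<bar>g a b - \<phi> a\<bar> < \<epsilon>"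
proof -
  show cont: "continuous_on M \<phi>"
    unfolding continuous_on_iff
  proof (intro ballI allI impI)
    fix x and e :: real assume x: "x \<in> M" and "e > 0"
    then have e2: "e / 2 > 0" by simp
    obtain \<delta> where \<delta>: "\<delta> > 0" "\<And>a b. a \<in> M \<Longrightarrow> b \<in> M \<Longrightarrow> a \<noteq> b \<Longrightarrow> dist a x < \<delta> \<Longrightarrow> dist b x < \<delta> \<Longrightarrow> \<bar>g a b - \<phi> x\<bar> < e / 2"
      using lim[OF x e2] by blast
    have "dist (\<phi> y) (\<phi> x) < e" if y: "y \<in> M" "dist y x < \<delta>" for y
    proof -
      obtain \<delta>' where \<delta>': "\<delta>' > 0" "\<And>a b. a \<in> M \<Longrightarrow> b \<in> M \<Longrightarrow> a \<noteq> b \<Longrightarrow> dist a y < \<delta>' \<Longrightarrow> dist b y < \<delta>' \<Longrightarrow> \<bar>g a b - \<phi> y\<bar> < e / 2"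
        using lim[OF y(1) e2] by blast
      have "min \<delta>' (\<delta> - dist y x) > 0" using \<delta>'(1) y(2) by simp
      then obtain b where b: "b \<in> M" "b \<noteq> y" "dist b y < min \<delta>' (\<delta> - dist y x)"
        using M(2)[OF y(1)] unfolding islimpt_approachable by blast
      have "dist b x < \<delta>" using b(3) dist_triangle[of b x y] by simp
      then have "\<bar>g y b - \<phi> x\<bar> < e / 2" using y b by (intro \<delta>) auto
      moreover have "\<bar>g y b - \<phi> y\<bar> < e / 2" using y b \<delta>'(1) by (intro \<delta>') auto
      ultimately show ?thesis unfolding dist_real_def by linarith
    qed
    with \<delta>(1) show "\<exists>d>0. \<forall>x'\<in>M. dist x' x < d \<longrightarrow> dist (\<phi> x') (\<phi> x) < e" by blast
  qed
  assume \<epsilon>: "\<epsilon> > 0"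
  show "\<exists>\<delta>>0. \<forall>a\<in>M. \<forall>b\<in>M. a \<noteq> b \<longrightarrow> dist a b < \<delta> \<longrightarrow> \<bar>g a b - \<phi> a\<bar> < \<epsilon>"
  proof (rule ccontr)
    assume neg: "\<not> ?thesis"
    have "\<exists>a b. a \<in> M \<and> b \<in> M \<and> a \<noteq> b \<and> dist a b < inverse (real (Suc n)) \<and> \<bar>g a b - \<phi> a\<bar> \<ge> \<epsilon>" for n
    proof (rule ccontr)
      assume "\<not> ?thesis"
      then have "\<forall>a\<in>M. \<forall>b\<in>M. a \<noteq> b \<longrightarrow> dist a b < inverse (real (Suc n)) \<longrightarrow> \<bar>g a b - \<phi> a\<bar> < \<epsilon>"
        by (meson not_less)
      moreover have "inverse (real (Suc n)) > 0" by simp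
      ultimately show False using neg by blast
    qed
    then obtain X Y where XY: "\<And>n. X n \<in> M \<and> Y n \<in> M \<and> X n \<noteq> Y n \<and> dist (X n) (Y n) < inverse (real (Suc n))
        \<and> \<bar>g (X n) (Y n) - \<phi> (X n)\<bar> \<ge> \<epsilon>"
      by metis
    obtain x r where x: "x \<in> M" "strict_mono r" "(X \<circ> r) \<longlonglongrightarrow> x"
      using M(1) XY unfolding compact_def by metis
    have "(\<lambda>n. dist (X n) (Y n)) \<longlonglongrightarrow> 0"
      by (rule real_tendsto_sandwich[OF _ _ tendsto_const LIMSEQ_inverse_real_of_nat])
        (use XY in \<open>auto intro!: always_eventually less_imp_le\<close>)
    then have d: "(\<lambda>n. dist (X (r n)) (Y (r n))) \<longlonglongrightarrow> 0"
      using LIMSEQ_subseq_LIMSEQ[OF _ x(2)] by (auto simp: o_def)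
    obtain \<delta> where \<delta>: "\<delta> > 0" "\<And>a b. a \<in> M \<Longrightarrow> b \<in> M \<Longrightarrow> a \<noteq> b \<Longrightarrow> dist a x < \<delta> \<Longrightarrow> dist b x < \<delta> \<Longrightarrow> \<bar>g a b - \<phi> x\<bar> < \<epsilon> / 2"
      using lim[OF x(1), of "\<epsilon> / 2"] \<epsilon> by auto
    have "(\<lambda>n. \<phi> (X (r n))) \<longlonglongrightarrow> \<phi> x"
      using continuous_on_tendsto_compose[OF cont x(3,1)] XY by (simp add: o_def)
    then have "\<forall>\<^sub>F n in sequentially. dist (\<phi> (X (r n))) (\<phi> x) < \<epsilon> / 2"
      using \<epsilon> by (intro tendstoD) auto
    moreover have "\<forall>\<^sub>F n in sequentially. dist (X (r n)) x < \<delta> / 2"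
      using tendstoD[OF x(3), of "\<delta> / 2"] \<delta>(1) by (simp add: o_def)
    moreover have "\<forall>\<^sub>F n in sequentially. dist (X (r n)) (Y (r n)) < \<delta> / 2"
      using order_tendstoD(2)[OF d, of "\<delta> / 2"] \<delta>(1) by simp
    ultimately have "\<forall>\<^sub>F n in sequentially. False"
    proof eventually_elim
      case (elim n)
      have "dist (Y (r n)) x < \<delta>"
        using elim dist_triangle[of "Y (r n)" x "X (r n)"] by (simp add: dist_commute)
      moreover have "dist (X (r n)) x < \<delta>" using elim \<delta>(1) by linarith
      ultimately have "\<bar>g (X (r n)) (Y (r n)) - \<phi> x\<bar> < \<epsilon> / 2"
        using XY[of "r n"] by (intro \<delta>(2)) auto
      with elim(1) XY[of "r n"] show False unfolding dist_real_def by linarith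
    qed
    then show False by simp
  qed
qed

text \<open>Unit limits of secants at \<open>x\<close> are \<open>u x\<close> or
  \<open>- u x\<close>, so strict differentiability forces the ratio of distances to
  \<open>\<bar>c x\<bar>\<close> along a subsequence of any pairs tending to \<open>x\<close>.
  Logarithms make the stretch additive along orbits.\<close>

lemma C1_regular_stretch:
  assumes f: "annulus_lift f F" and F: "\<And>w. (F has_derivative blinfun_apply (F' w)) (at w)"
    and cont: "continuous_on UNIV F'" and inj: "\<And>w v. F' w v = 0 \<Longrightarrow> v = 0"
    and fM: "f ` M = M" and reg: "\<forall>x\<in>M. C1_regular_at M x" and limpt: "\<And>x. x \<in> M \<Longrightarrow> x islimpt M"
  obtains u c where "\<And>x. x \<in> M \<Longrightarrow> norm (u x) = 1" "\<And>x. x \<in> M \<Longrightarrow> c x \<noteq> 0"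
    "\<And>z. annulus_proj z \<in> M \<Longrightarrow> F' z (u (annulus_proj z)) = c (annulus_proj z) *\<^sub>R u (f (annulus_proj z))"
    "\<And>x \<epsilon>. x \<in> M \<Longrightarrow> \<epsilon> > 0 \<Longrightarrow> \<exists>\<delta>>0. \<forall>a\<in>M. \<forall>b\<in>M. a \<noteq> b \<longrightarrow> dist a x < \<delta> \<longrightarrow> dist b x < \<delta> \<longrightarrow>
      \<bar>ln (dist (f a) (f b) / dist a b) - ln \<bar>c x\<bar>\<bar> < \<epsilon>"
proof -
  have "\<exists>u. u \<in> paratingent_cone M x \<and> norm u = 1" if "x \<in> M" for x
    using islimpt_paratingent[OF limpt[OF that] that] by blast
  \<comment> \<open>The choice is pointwise and determined up to sign, hence the sign of
    \<open>c\<close> is arbitrary while \<open>\<bar>c x\<bar>\<close> is not.\<close>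
  then obtain u where u: "\<And>x. x \<in> M \<Longrightarrow> u x \<in> paratingent_cone M x \<and> norm (u x) = 1" by metis
  define A where "A x = annulus_deriv f x" for x
  have A: "A (annulus_proj z) = blinfun_apply (F' z)" for z
    unfolding A_def by (rule annulus_deriv_eq[OF f F])
  have fx: "f x \<in> M" if "x \<in> M" for x using that fM by blast
  have "\<exists>c. A x (u x) = c *\<^sub>R u (f x)" if x: "x \<in> M" for x
  proof -
    obtain z where z: "x = annulus_proj z" by (rule annulus_proj_surj)
    have "A x (u x) \<in> paratingent_cone M (f x)"
      unfolding z A using x u fM by (intro paratingent_cone_deriv[OF f F cont]) (auto simp: z)
    then show ?thesis
      using reg u[OF fx[OF x]] fx[OF x] paratingent_line[of M "f x" "u (f x)" "A x (u x)"] by metis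
  qed
  then obtain c where c: "\<And>x. x \<in> M \<Longrightarrow> A x (u x) = c x *\<^sub>R u (f x)" by metis
  have c0: "c x \<noteq> 0" if x: "x \<in> M" for x
  proof
    assume "c x = 0"
    obtain z where z: "x = annulus_proj z" by (rule annulus_proj_surj)
    then have "F' z (u x) = 0" using c[OF x] \<open>c x = 0\<close> by (simp add: A)
    then have "u x = 0" by (rule inj)
    with u[OF x] show False by simp
  qed
  have key: "\<exists>\<delta>>0. \<forall>a\<in>M. \<forall>b\<in>M. a \<noteq> b \<longrightarrow> dist a x < \<delta> \<longrightarrow> dist b x < \<delta> \<longrightarrow>
      \<bar>ln (dist (f a) (f b) / dist a b) - ln \<bar>c x\<bar>\<bar> < \<epsilon>" if x: "x \<in> M" and \<epsilon>: "\<epsilon> > 0" for x \<epsilon>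
  proof -
    obtain z where z: "x = annulus_proj z" by (rule annulus_proj_surj)
    have sub: "\<exists>r :: nat \<Rightarrow> nat. (\<lambda>n. ln (dist (f (X (r n))) (f (Y (r n))) / dist (X (r n)) (Y (r n)))) \<longlonglongrightarrow> ln \<bar>c x\<bar>"
      if XY: "\<And>n. X n \<in> M" "\<And>n. Y n \<in> M" "\<And>n. X n \<noteq> Y n" "X \<longlonglongrightarrow> x" "Y \<longlonglongrightarrow> x" for X Y
    proof -
      obtain r v where r: "strict_mono r" and v: "v \<in> paratingent_cone M x" "norm v = 1"
        and lim: "(\<lambda>n. annulus_diff (X (r n)) (Y (r n)) /\<^sub>R dist (X (r n)) (Y (r n))) \<longlonglongrightarrow> v"
        using secants_subseq_cone[of X M Y x] XY by blast
      have Xr: "(\<lambda>n. X (r n)) \<longlonglongrightarrow> annulus_proj z" and Yr: "(\<lambda>n. Y (r n)) \<longlonglongrightarrow> annulus_proj z"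
        using LIMSEQ_subseq_LIMSEQ[OF XY(4) r] LIMSEQ_subseq_LIMSEQ[OF XY(5) r] by (auto simp: o_def z)
      obtain k where k: "v = k *\<^sub>R u x"
        using paratingent_line[of M x "u x" v] reg x u[OF x] v by blast
      have "(\<lambda>n. annulus_diff (f (X (r n))) (f (Y (r n))) /\<^sub>R dist (X (r n)) (Y (r n))) \<longlonglongrightarrow> F' z v"
        by (rule annulus_strict_derivative[OF f F cont Xr Yr _ lim]) (use XY in simp)
      then have "(\<lambda>n. norm (annulus_diff (f (X (r n))) (f (Y (r n))) /\<^sub>R dist (X (r n)) (Y (r n)))) \<longlonglongrightarrow> norm (F' z v)"
        by (rule tendsto_norm)
      moreover have "norm (F' z v) = \<bar>c x\<bar>"
      proof -
        have "F' z v = k *\<^sub>R c x *\<^sub>R u (f x)"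
          using c[OF x] A[of z] by (simp add: k blinfun.scaleR_right z)
        moreover have "\<bar>k\<bar> = 1" using v(2) u[OF x] by (simp add: k)
        ultimately show ?thesis using u[OF fx[OF x]] by (simp add: abs_mult)
      qed
      ultimately have "(\<lambda>n. dist (f (X (r n))) (f (Y (r n))) / dist (X (r n)) (Y (r n))) \<longlonglongrightarrow> \<bar>c x\<bar>"
        by (simp add: norm_annulus_diff divide_inverse mult.commute)
      then have "(\<lambda>n. ln (dist (f (X (r n))) (f (Y (r n))) / dist (X (r n)) (Y (r n)))) \<longlonglongrightarrow> ln \<bar>c x\<bar>"
        by (rule tendsto_ln) (use c0[OF x] in simp)
      then show ?thesis by blast
    qed
    obtain \<delta> where "\<delta> > 0" "\<And>a b. a \<in> M \<Longrightarrow> b \<in> M \<Longrightarrow> a \<noteq> b \<Longrightarrow> dist a x < \<delta> \<Longrightarrow> dist b x < \<delta>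
        \<Longrightarrow> \<bar>ln (dist (f a) (f b) / dist a b) - ln \<bar>c x\<bar>\<bar> < \<epsilon>"
      using LIMSEQ_pair_criterion[of M x "\<lambda>a b. ln (dist (f a) (f b) / dist a b)" "ln \<bar>c x\<bar>" \<epsilon>, OF sub \<epsilon>] by blast
    then show ?thesis by blast
  qed
  show ?thesis
  proof (rule that)
    show "F' z (u (annulus_proj z)) = c (annulus_proj z) *\<^sub>R u (f (annulus_proj z))"
      if "annulus_proj z \<in> M" for z
      using c[OF that] by (simp add: A)
  qed (use u c0 key in auto)
qed

section \<open>Transfer of averages from the circle to the Aubry-Mather set\<close>

lemma dist_circle_of_le: "dist (circle_of s) (circle_of t) \<le> dist s t"
  using abs_circle_diff_le[of s t 0] by (simp add: dist_circle_def dist_real_def)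

lemma irrational_AM_setE:
  assumes "irrational_AM_set f M"
  obtains h H \<rho> where "circle_lift h H" "\<And>x. x \<in> M \<Longrightarrow> fst (f x) = h (fst x)" "circle_lift_map H \<rho>"
proof -
  obtain F \<rho> h H where h: "orientation_preserving_homeo h" and fh: "\<forall>x\<in>M. fst (f x) = h (fst x)"
    and H: "circle_lift h H" and \<rho>: "has_rotation_number H \<rho>" "\<rho> \<notin> \<rat>"
    using assms unfolding irrational_AM_set_def AM_rotation_number_def by blast
  have "circle_lift_map H \<rho>"
    using orientation_preserving_lift[OF h H] \<rho> by unfold_locales auto
  then show ?thesis using that[OF H] fh by blast
qed

lemma circle_lift_funpow:
  assumes H: "circle_lift h H" and fh: "\<And>x. x \<in> M \<Longrightarrow> fst (f x) = h (fst x)" and fM: "f ` M = M"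
    and x: "x \<in> M" "circle_of t = fst x"
  shows "(f ^^ n) x \<in> M \<and> circle_of ((H ^^ n) t) = fst ((f ^^ n) x)"
proof (induction n)
  case (Suc n)
  then have "f ((f ^^ n) x) \<in> M" using fM by blast
  then show ?case using Suc fh[of "(f ^^ n) x"] H by (simp add: circle_lift_def)
qed (use x in simp)

text \<open>A finite \<open>M\<close> contains an orbit with a repetition; above it some positive
  iterate of \<open>H\<close> moves a point by an integer, which would make \<open>\<rho>\<close>
  rational.\<close>

lemma ordered_irrational_infinite:
  assumes H: "circle_lift h H" and fh: "\<And>x. x \<in> M \<Longrightarrow> fst (f x) = h (fst x)" and rot: "circle_lift_map H \<rho>"
    and M: "ordered_set f M"
  shows "infinite M"
proof
  assume "finite M"
  interpret circle_lift_map H \<rho> by (rule rot)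
  obtain x where x: "x \<in> M" using ordered_setD(1)[OF M] by blast
  obtain t where t: "circle_of t = fst x" by (metis circle_of_surj)
  note orb = circle_lift_funpow[OF H fh ordered_setD(3)[OF M] x t]
  have "range (\<lambda>n. (f ^^ n) x) \<subseteq> M" using orb by blast
  then have "finite (range (\<lambda>n. (f ^^ n) x))" using \<open>finite M\<close> by (rule finite_subset)
  then have "\<not> inj (\<lambda>n. (f ^^ n) x)" using finite_imageD[of "\<lambda>n. (f ^^ n) x" UNIV] by auto
  then obtain m n where mn: "m < n" "(f ^^ m) x = (f ^^ n) x"
    unfolding inj_on_def by (metis nat_neq_iff)
  then have "circle_of ((H ^^ n) t) = circle_of ((H ^^ m) t)" using orb by simp
  then have "(H ^^ n) t - (H ^^ m) t \<in> \<int>" by (simp add: circle_of_eq_iff)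
  then obtain p :: int where "(H ^^ n) t - (H ^^ m) t = of_int p" by (auto elim: Ints_cases)
  moreover have "(H ^^ n) t = (H ^^ (n - m)) ((H ^^ m) t)"
    using mn(1) by (metis add_diff_inverse_nat comp_apply funpow_add add.commute less_imp_not_less)
  ultimately have "(H ^^ (n - m)) ((H ^^ m) t) = (H ^^ m) t + of_int p" by simp
  from no_periodic[OF this] mn(1) show False by simp
qed

text \<open>\<open>M\<close> is the graph over \<open>K\<close> of a map \<open>s\<close>,
  continuous by compactness of \<open>M\<close>. So \<open>\<phi>\<close> becomes a periodic
  function \<open>\<psi>\<close> on the preimage \<open>X\<close> of \<open>K\<close> in the line,
  and orbits of \<open>f\<close> on \<open>M\<close> correspond to orbits of \<open>H\<close> on
  \<open>X\<close>. Uniform continuity is obtained on the compact \<open>K\<close> before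
  lifting.\<close>

lemma uniform_average_AM_set:
  assumes H: "circle_lift h H" and fh: "\<And>x. x \<in> M \<Longrightarrow> fst (f x) = h (fst x)" and rot: "circle_lift_map H \<rho>"
    and cM: "compact M" and fM: "f ` M = M" and inj: "inj_on fst M" and cont: "continuous_on M \<phi>"
  shows "uniform_average M f \<phi>"
proof -
  interpret circle_lift_map H \<rho> by (rule rot)
  define K where "K = fst ` M"
  define s where "s = the_inv_into M fst"
  define X where "X = {t. circle_of t \<in> K}"
  define \<psi> where "\<psi> t = \<phi> (s (circle_of t))" for t
  have s: "s (fst x) = x" if "x \<in> M" for x
    unfolding s_def by (rule the_inv_into_f_f[OF inj that])
  have "continuous_on K s"
    unfolding s_def K_def by (rule continuous_on_inv_into[OF _ cM inj]) (intro continuous_intros)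
  moreover have "s ` K \<subseteq> M" using s by (auto simp: K_def)
  ultimately have "continuous_on K (\<lambda>k. \<phi> (s k))"
    by (rule continuous_on_compose2[OF cont])
  moreover have "compact K"
    unfolding K_def by (intro compact_continuous_image cM continuous_intros)
  ultimately have uc: "uniformly_continuous_on K (\<lambda>k. \<phi> (s k))"
    by (rule compact_uniformly_continuous)
  have "uniformly_continuous_on X \<psi>"
    unfolding uniformly_continuous_on_def
  proof (intro allI impI)
    fix e :: real assume "e > 0"
    then obtain d where d: "d > 0" "\<And>k l. k \<in> K \<Longrightarrow> l \<in> K \<Longrightarrow> dist l k < d \<Longrightarrow> dist (\<phi> (s l)) (\<phi> (s k)) < e"
      using uc unfolding uniformly_continuous_on_def by blast
    have "dist (\<psi> y) (\<psi> x) < e" if "x \<in> X" "y \<in> X" "dist y x < d" for x y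
      unfolding \<psi>_def using that dist_circle_of_le[of y x] by (intro d(2)) (auto simp: X_def)
    with d(1) show "\<exists>d>0. \<forall>x\<in>X. \<forall>x'\<in>X. dist x' x < d \<longrightarrow> dist (\<psi> x') (\<psi> x) < e" by blast
  qed
  moreover have "H ` X \<subseteq> X"
  proof
    fix y assume "y \<in> H ` X"
    then obtain t x where "y = H t" and x: "x \<in> M" "circle_of t = fst x" by (auto simp: X_def K_def)
    then have "circle_of y = fst (f x)" using H fh by (simp add: circle_lift_def)
    moreover have "f x \<in> M" using x fM by blast
    ultimately show "y \<in> X" by (simp add: X_def K_def)
  qed
  ultimately have avg: "uniform_average X H \<psi>"
    by (intro uniform_average_continuous) (auto simp: X_def \<psi>_def)
  show ?thesis
    unfolding uniform_average_def
  proof (intro allI impI)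
    fix \<epsilon> :: real assume \<epsilon>: "\<epsilon> > 0"
    obtain c C where C: "\<And>n t. t \<in> X \<Longrightarrow> \<bar>(\<Sum>i<n. \<psi> ((H ^^ i) t)) - real n * c\<bar> \<le> \<epsilon> * real n + C"
      using uniform_averageD[OF avg \<epsilon>] by blast
    have "\<bar>(\<Sum>i<n. \<phi> ((f ^^ i) x)) - real n * c\<bar> \<le> \<epsilon> * real n + C" if x: "x \<in> M" for n x
    proof -
      obtain t where t: "circle_of t = fst x" by (metis circle_of_surj)
      have "\<psi> ((H ^^ i) t) = \<phi> ((f ^^ i) x)" for i
        using circle_lift_funpow[OF H fh fM x t, of i] s by (simp add: \<psi>_def)
      moreover have "t \<in> X" using t x by (simp add: X_def K_def)
      ultimately show ?thesis using C[of t n] by simp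
    qed
    then show "\<exists>c C. \<forall>n. \<forall>x\<in>M. \<bar>(\<Sum>i<n. \<phi> ((f ^^ i) x)) - real n * c\<bar> \<le> \<epsilon> * real n + C" by blast
  qed
qed

text \<open>Periodicity reduces the preimage of \<open>M\<close> to one period in the angle, over
  which \<open>F'\<close> is bounded by compactness.\<close>

lemma C1_lift_bounded:
  assumes cM: "compact M" and cont: "continuous_on UNIV (F' :: real \<times> real \<Rightarrow> (real \<times> real) \<Rightarrow>\<^sub>L (real \<times> real))"
    and per: "\<And>z k. F' (z + (of_int k, 0)) = F' z"
  obtains B where "\<And>z v. annulus_proj z \<in> M \<Longrightarrow> norm (F' z v) \<le> B * norm v"
proof -
  have "compact ({0..1::real} \<times> snd ` M)"
    by (intro compact_Times compact_Icc compact_continuous_image[OF _ cM] continuous_on_snd continuous_on_id)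
  from compact_continuous_image[OF continuous_on_subset[OF cont subset_UNIV] this]
  have "bounded (F' ` ({0..1} \<times> snd ` M))" by (rule compact_imp_bounded)
  then obtain B where B: "\<And>w. w \<in> {0..1} \<times> snd ` M \<Longrightarrow> norm (F' w) \<le> B"
    unfolding bounded_iff by blast
  have "norm (F' z v) \<le> B * norm v" if z: "annulus_proj z \<in> M" for z v
  proof -
    define w where "w = z + (of_int (- \<lfloor>fst z\<rfloor>), 0)"
    have "fst w = fst z - of_int \<lfloor>fst z\<rfloor>" by (simp add: w_def)
    then have "0 \<le> fst w" "fst w \<le> 1" by linarith+
    moreover have "snd w \<in> snd ` M" using imageI[OF z, of snd] by (simp add: w_def annulus_proj_def)
    ultimately have "norm (F' w) \<le> B" by (intro B) (auto simp: mem_Times_iff)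
    moreover have "F' w = F' z" unfolding w_def by (rule per)
    ultimately show ?thesis
      using norm_blinfun[of "F' z" v] mult_right_mono[of "norm (F' z)" B "norm v"] by simp
  qed
  then show ?thesis by (rule that)
qed

section \<open>Lyapunov exponents at the points of the set\<close>

lemma annulus_deriv_funpow:
  assumes f: "annulus_lift f F" and F: "\<And>w. (F has_derivative blinfun_apply (F' w)) (at w)"
  shows "annulus_deriv (f ^^ 0) (annulus_proj z) v = v"
    and "annulus_deriv (f ^^ Suc n) (annulus_proj z) v
      = F' ((F ^^ n) z) (annulus_deriv (f ^^ n) (annulus_proj z) v)"
proof -
  define W where "W = rec_nat (\<lambda>v. v) (\<lambda>n L v. F' ((F ^^ n) z) (L v))"
  have W: "((F ^^ n) has_derivative W n) (at z)" for n
  proof (induction n)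
    case 0 then show ?case by (simp add: W_def id_def)
  next
    case (Suc n)
    from has_derivative_compose[OF Suc F] show ?case by (simp add: W_def o_def)
  qed
  have *: "annulus_deriv (f ^^ n) (annulus_proj z) = W n" for n
    by (rule annulus_deriv_eq[OF annulus_lift_funpow[OF f] W])
  show "annulus_deriv (f ^^ 0) (annulus_proj z) v = v"
    unfolding * by (simp add: W_def)
  show "annulus_deriv (f ^^ Suc n) (annulus_proj z) v
      = F' ((F ^^ n) z) (annulus_deriv (f ^^ n) (annulus_proj z) v)"
    unfolding * by (simp add: W_def)
qed

lemma C1_regular_AM_set_exponent:
  assumes twist: "twist_map f" and ex: "exact_symplectic f" and AM: "irrational_AM_set f M"
    and reg: "\<forall>x\<in>M. C1_regular_at M x" and x: "x \<in> M" and v: "v \<noteq> 0"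
  shows "has_lyapunov_exponent f x v 0"
proof -
  have f: "annulus_C1_diffeo f" by (rule twist_map_C1_diffeo[OF twist])
  then have inj: "inj f" by (simp add: annulus_C1_diffeo_def bij_is_inj)
  obtain F F' where F: "annulus_lift f F" and F': "\<And>w. (F has_derivative blinfun_apply (F' w)) (at w)"
    and cont: "continuous_on UNIV F'"
    using C1_diffeo_lift[OF f] by blast
  have area: "area_form (F' z a) (F' z b) = area_form a b" for z a b
    by (rule exact_symplectic_lift[OF ex F F' cont])
  \<comment> \<open>Nondegeneracy of the area form: a kernel vector would span zero area with both
    basis vectors.\<close>
  have ker: "a = 0" if "F' z a = 0" for z a
  proof -
    have "area_form a b = 0" for b using area[of z a b] that by (simp add: area_form_def)
    from this[of "(0, 1)"] this[of "(1, 0)"] show ?thesis by (simp add: area_form_def prod_eq_iff)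
  qed
  have AMM: "aubry_mather_set f M" using AM by (simp add: irrational_AM_set_def)
  have ord: "ordered_set f M" using AMM unfolding aubry_mather_set_def by (rule conjunct1)
  note cM = ordered_setD(2)[OF ord] and fM = ordered_setD(3)[OF ord]
  obtain h H \<rho> where h: "circle_lift h H" "\<And>x. x \<in> M \<Longrightarrow> fst (f x) = h (fst x)" "circle_lift_map H \<rho>"
    using irrational_AM_setE[OF AM] by blast
  have inf: "infinite M" by (rule ordered_irrational_infinite[OF h ord])
  note limpt = AM_set_islimpt[OF f AMM inf]
  obtain u c where u: "\<And>x. x \<in> M \<Longrightarrow> norm (u x) = 1" and c0: "\<And>x. x \<in> M \<Longrightarrow> c x \<noteq> 0"
    and Fu: "\<And>z. annulus_proj z \<in> M \<Longrightarrow> F' z (u (annulus_proj z)) = c (annulus_proj z) *\<^sub>R u (f (annulus_proj z))"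
    and lim: "\<And>x \<epsilon>. x \<in> M \<Longrightarrow> \<epsilon> > 0 \<Longrightarrow> \<exists>\<delta>>0. \<forall>a\<in>M. \<forall>b\<in>M. a \<noteq> b \<longrightarrow> dist a x < \<delta> \<longrightarrow> dist b x < \<delta> \<longrightarrow>
      \<bar>ln (dist (f a) (f b) / dist a b) - ln \<bar>c x\<bar>\<bar> < \<epsilon>"
    by (rule C1_regular_stretch[OF F F' cont ker fM reg limpt], assumption, assumption, rule that)
  define \<phi> where "\<phi> x = ln \<bar>c x\<bar>" for x
  define g where "g a b = ln (dist (f a) (f b) / dist a b)" for a b
  have cont_\<phi>: "continuous_on M \<phi>"
    by (rule pair_limit_uniform(1)[OF cM limpt, of g]) (use lim in \<open>simp_all add: g_def \<phi>_def\<close>)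
  have unif: "\<exists>\<delta>>0. \<forall>a\<in>M. \<forall>b\<in>M. a \<noteq> b \<longrightarrow> dist a b < \<delta> \<longrightarrow> \<bar>g a b - \<phi> a\<bar> < \<epsilon>" if "\<epsilon> > 0" for \<epsilon>
    by (rule pair_limit_uniform(2)[OF cM limpt _ that]) (use lim in \<open>simp_all add: g_def \<phi>_def\<close>)
  have cf: "continuous_on M f" by (rule annulus_lift_continuous[OF F])
  have avg: "uniform_average M f \<phi>"
    by (rule uniform_average_AM_set[OF h cM fM ordered_set_fst_inj[OF twist ord] cont_\<phi>])
  have stretch: "\<exists>\<delta>>0. \<forall>a\<in>M. \<forall>b\<in>M. dist a b < \<delta> \<longrightarrow>
      exp (\<phi> a - \<epsilon>) * dist a b \<le> dist (f a) (f b) \<and> dist (f a) (f b) \<le> exp (\<phi> a + \<epsilon>) * dist a b"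
    if \<epsilon>: "\<epsilon> > 0" for \<epsilon>
  proof -
    obtain \<delta> where \<delta>: "\<delta> > 0" "\<And>a b. a \<in> M \<Longrightarrow> b \<in> M \<Longrightarrow> a \<noteq> b \<Longrightarrow> dist a b < \<delta> \<Longrightarrow>
        \<bar>ln (dist (f a) (f b) / dist a b) - \<phi> a\<bar> < \<epsilon>"
      using unif[OF \<epsilon>] unfolding g_def by blast
    have "exp (\<phi> a - \<epsilon>) * dist a b \<le> dist (f a) (f b) \<and> dist (f a) (f b) \<le> exp (\<phi> a + \<epsilon>) * dist a b"
      if ab: "a \<in> M" "b \<in> M" "dist a b < \<delta>" for a b
    proof (cases "a = b")
      case False
      define q where "q = dist (f a) (f b) / dist a b"
      have q: "q > 0" "dist (f a) (f b) = q * dist a b"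
        using False inj by (auto simp: q_def inj_eq)
      have "exp (\<phi> a - \<epsilon>) \<le> exp (ln q)" "exp (ln q) \<le> exp (\<phi> a + \<epsilon>)"
        using \<delta>(2)[OF ab(1,2) False ab(3)] unfolding q_def[symmetric] exp_le_cancel_iff by linarith+
      then show ?thesis using q by (auto intro: mult_right_mono)
    qed simp
    with \<delta>(1) show ?thesis by blast
  qed
  \<comment> \<open>Both sides are the derivative of \<open>f\<close> at the same point of the
    annulus.\<close>
  have per: "F' (z + (of_int k, 0)) = F' z" for z k
    using annulus_deriv_eq[OF F F', of "z + (of_int k, 0)"] annulus_deriv_eq[OF F F', of z]
    by (simp add: blinfun_apply_inject)
  obtain B where B: "\<And>z v. annulus_proj z \<in> M \<Longrightarrow> norm (F' z v) \<le> B * norm v"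
    using C1_lift_bounded[OF cM cont per] by blast
  obtain z where z: "x = annulus_proj z" by (rule annulus_proj_surj)
  have orb: "annulus_proj ((F ^^ n) z) = (f ^^ n) x" for n
    unfolding z by (rule annulus_lift_proj[OF annulus_lift_funpow[OF F]])
  have fx: "(f ^^ n) x \<in> M" for n
    by (induction n) (use x fM in auto)
  show ?thesis
    unfolding has_lyapunov_exponent_def
  proof (rule area_preserving_cocycle_exponent)
    show "linear (blinfun_apply (F' ((F ^^ n) z)))" for n
      by (rule bounded_linear.linear[OF blinfun.bounded_linear_right])
    show "area_form (F' ((F ^^ n) z) a) (F' ((F ^^ n) z) b) = area_form a b" for n a b
      by (rule area)
    show "norm (F' ((F ^^ n) z) a) \<le> B * norm a" for n a
      by (rule B) (simp add: orb fx)
    show "norm (u ((f ^^ n) x)) = 1" for n by (rule u[OF fx])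
    show "F' ((F ^^ n) z) (u ((f ^^ n) x)) = c ((f ^^ n) x) *\<^sub>R u ((f ^^ Suc n) x)" for n
      using Fu[of "(F ^^ n) z"] fx[of n] by (simp add: orb)
    show "c ((f ^^ n) x) \<noteq> 0" for n by (rule c0[OF fx])
    show "\<exists>K. \<forall>n. \<bar>\<Sum>i<n. ln \<bar>c ((f ^^ i) x)\<bar>\<bar> \<le> \<epsilon> * real n + K" if \<epsilon>: "\<epsilon> > 0" for \<epsilon>
    proof -
      obtain K where "\<And>n y. y \<in> M \<Longrightarrow> \<bar>\<Sum>i<n. \<phi> ((f ^^ i) y)\<bar> \<le> \<epsilon> * real n + K"
        using local_stretch_average_zero[OF cM inf fM inj_on_subset[OF inj subset_UNIV] cf _ avg \<epsilon>] stretch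
        by blast
      then show ?thesis using x unfolding \<phi>_def by blast
    qed
    show "annulus_deriv (f ^^ Suc n) x v = F' ((F ^^ n) z) (annulus_deriv (f ^^ n) x v)" for n
      unfolding z by (rule annulus_deriv_funpow(2)[OF F F'])
    show "annulus_deriv (f ^^ 0) x v \<noteq> 0"
      using v unfolding z annulus_deriv_funpow(1)[OF F F'] .
  qed
qed

theorem corollary3:
  fixes f :: "annulus \<Rightarrow> annulus" and M :: "annulus set" and \<mu> :: "annulus measure"
  assumes "twist_map f"
    and "exact_symplectic f"
    and "irrational_AM_set f M"
    and "\<forall>x\<in>M. C1_regular_at M x"
    and "invariant_borel_probability f M \<mu>"
  shows "has_lyapunov_exponents f \<mu> {0}"
proof -
  note exponent = C1_regular_AM_set_exponent[OF assms(1-4)]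
  have sets: "sets \<mu> = sets borel" and prob: "prob_space \<mu>" and one: "emeasure \<mu> M = 1"
    using assms(5) by (auto simp: invariant_borel_probability_def)
  interpret prob_space \<mu> by (rule prob)
  have "ordered_set f M"
    using assms(3) unfolding irrational_AM_set_def aubry_mather_set_def by blast
  then have "M \<in> sets \<mu>"
    unfolding sets by (intro borel_closed compact_imp_closed ordered_setD(2))
  moreover have "prob M = 1" using one by (simp add: measure_def)
  ultimately have "AE x in \<mu>. x \<in> M" by (simp add: prob_eq_1)
  then show ?thesis
    unfolding has_lyapunov_exponents_def
  proof eventually_elim
    case (elim x)
    \<comment> \<open>The exponent 0 has to be attained, so some nonzero vector must be
      exhibited.\<close>
    have "(1, 0) \<noteq> (0 :: real \<times> real)" by (simp add: zero_prod_def)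
    with exponent[OF elim] show ?case by blast
  qed
qed

end
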